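(* The kernel of every point in $\mathfrak{M}_1$ is a nonzero nonmaximal ideal of $H^\infty$.
   Context: $\mathbb{K}$ is an algebraically closed field, complete with respect to a nontrivial nonarchimedean absolute value $|\cdot|$; $\mathbb{D} = \{z \in \mathbb{K} : |z|<1\}$; $\mathbb{N}=\{1,2,\dots\}$. $H^\infty$ is the Banach $\mathbb{K}$-algebra of bounded power series $f(z)=\sum_{n\ge 0} a_n z^n$ on $\mathbb{D}$, with norm $\|f\| = \sup_n |a_n| = \sup_{z\in\mathbb{D}}|f(z)|$. For a seminorm $\varphi$ on $H^\infty$, $\ker\varphi = \{f\in H^\infty : \varphi(f)=0\}$. $D^+(z,r)$ is the closed disk with center $z$ and radius $r$, and for a disk $D\subset\mathbb{D}$, $\zeta_D(f) := \sup_{z\in D}|f(z)|$ for $f\in H^\infty$ (a multiplicative seminorm bounded by $\|\cdot\|$). For a sequence $\mathbf{z}=(z_n)$ in $\mathbb{D}$ and a nonprincipal ultrafilter $\mathfrak{u}$ in $\mathbb{N}$, $\mathtt{Comp}_{\mathfrak{u}}(\mathbf{z})$ is the set of all sequences $\mathbf{k}=(k_n)$ in $\mathbb{N}$ for which there is $C\in\mathfrak{u}$ with $\inf_{n\in C}\prod_{m\in C, m\ne n}|z_n-z_m|^{k_m}>0$. For $\mathbf{k}\in\mathtt{Comp}_{\mathfrak{u}}(\mathbf{z})$ and $r\in(0,1)$, $\zeta_{\mathbf{z},\mathfrak{u}}^{\mathbf{k},r} := \lim_{\mathfrak{u}}\zeta_{D^+(z_n,\sqrt[k_n]{r})}$ (pointwise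 limit along $\mathfrak{u}$). $\mathfrak{M}_1$ is the set of all seminorms $\zeta_{\mathbf{z},\mathfrak{u}}^{\mathbf{k},r}$, where $\mathbf{z}$ ranges over sequences in $\mathbb{D}$, $\mathfrak{u}$ over nonprincipal ultrafilters in $\mathbb{N}$, $\mathbf{k}$ over $\mathtt{Comp}_{\mathfrak{u}}(\mathbf{z})$ and $r$ over $(0,1)$. *)

theory Defs
  imports
    "HOL-Analysis.Analysis"
    "HOL-Computational_Algebra.Computational_Algebra"
    "HOL-Algebra.Ideal"
begin

(* The library's norm is reserved for real normed vector spaces, hence a new constant.
   Definiteness, nonnegativity and the triangle inequality come from the metric. *)
class nonarch_valued_field = field + metric_space +
  fixes absval :: "'a \<Rightarrow> real"
  assumes dist_absval: "dist x y = absval (x - y)"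
    and absval_mult: "absval (x * y) = absval x * absval y"
    and absval_add: "absval (x + y) \<le> max (absval x) (absval y)"
    and absval_nontrivial: "\<exists>x. x \<noteq> 0 \<and> absval x \<noteq> 1"

class complete_alg_closed_nonarch_field =
  nonarch_valued_field + complete_space + alg_closed_field

(* Library's eval_fps needs a real Banach algebra, which the field is not. *)
definition ps_eval :: "'a::nonarch_valued_field fps \<Rightarrow> 'a \<Rightarrow> 'a" where
  "ps_eval f z = (\<Sum>n. fps_nth f n * z ^ n)"

definition Hinf :: "'a::nonarch_valued_field fps ring" where
  "Hinf = \<lparr>carrier = {f. bounded (range (fps_nth f))},
           mult = (*), one = 1, zero = 0, add = (+)\<rparr>"

definition zeta_disk :: "'a::nonarch_valued_field set \<Rightarrow> 'a fps \<Rightarrow> real" where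
  "zeta_disk D f = (SUP z\<in>D. absval (ps_eval f z))"

(* An ultrafilter is encoded as a filter u on nat, its members being the sets C with
   eventually (\<lambda>n. n \<in> C) u. *)
definition nonprincipal_ultrafilter :: "nat filter \<Rightarrow> bool" where
  "nonprincipal_ultrafilter u \<longleftrightarrow>
     u \<noteq> bot \<and> (\<forall>P. eventually P u \<or> eventually (\<lambda>n. \<not> P n) u) \<and>
     (\<forall>n. u \<noteq> principal {n})"

(* The possibly infinite product over m in C - {n} is the limit of its partial products.
   For points of the open unit disk all factors lie in [0,1], so this limit exists and
   does not depend on the order of the factors. The library's prodinf is not usable
   because it treats products tending to 0 as divergent. *)
definition comp_product ::
    "(nat \<Rightarrow> 'a::nonarch_valued_field) \<Rightarrow> (nat \<Rightarrow> nat) \<Rightarrow> nat set \<Rightarrow> nat \<Rightarrow> real" where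
  "comp_product z k C n =
     lim (\<lambda>N. \<Prod>m\<in>{m\<in>C. m \<noteq> n \<and> m < N}. absval (z n - z m) ^ k m)"

definition Comp :: "nat filter \<Rightarrow> (nat \<Rightarrow> 'a::nonarch_valued_field) \<Rightarrow> (nat \<Rightarrow> nat) set" where
  "Comp u z = {k. (\<forall>n. 1 \<le> k n) \<and>
     (\<exists>C. eventually (\<lambda>n. n \<in> C) u \<and> (INF n\<in>C. comp_product z k C n) > 0)}"

definition zeta_ultra ::
    "(nat \<Rightarrow> 'a::nonarch_valued_field) \<Rightarrow> nat filter \<Rightarrow> (nat \<Rightarrow> nat) \<Rightarrow> real \<Rightarrow> 'a fps \<Rightarrow> real" where
  "zeta_ultra z u k r f = Lim u (\<lambda>n. zeta_disk (cball (z n) (root (k n) r)) f)"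

(* Elements are functions on all formal power series; only their values on the carrier
   of Hinf are meaningful. *)
definition M1 :: "('a::nonarch_valued_field fps \<Rightarrow> real) set" where
  "M1 = {zeta_ultra z u k r | z u k r.
           range z \<subseteq> ball 0 1 \<and> nonprincipal_ultrafilter u \<and> k \<in> Comp u z \<and> 0 < r \<and> r < 1}"

definition seminorm_ker :: "('a::nonarch_valued_field fps \<Rightarrow> real) \<Rightarrow> 'a fps set" where
  "seminorm_ker \<phi> = {f \<in> carrier Hinf. \<phi> f = 0}"

end

theory Submission
  imports Defs
begin

text \<open>
  A point of \<open>M1\<close> is a limit along an ultrafilter \<open>u\<close> of the supremum seminorms of disks around
  \<open>z n\<close> of radius the \<open>k n\<close>-th root of \<open>r\<close>. Its kernel consists of the bounded series whose suprema
  over these disks tend to 0 along \<open>u\<close>, and series that tend to 0 along a filter on any family of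
  subsets of the unit disk form an ideal (\<open>seminorm_ker_zeta_ultra\<close>, \<open>ideal_null_ideal\<close>). A kernel
  element other than 0, and an ideal strictly between the kernel and the whole ring, both come from
  products over the points \<open>z m\<close>, with \<open>m\<close> in a suitable member \<open>C\<close> of \<open>u\<close>.

  Compatibility of \<open>k\<close> gives \<open>C\<close> and \<open>\<delta> > 0\<close> such that, for each \<open>n\<close> in \<open>C\<close>, every finite product
  of numbers \<open>|z n - z m|^k m\<close> with \<open>m\<close> in \<open>C - {n}\<close> is at least \<open>\<delta>\<close>. Comparing with one fixed \<open>z n\<close>, the
  same holds for the products of the \<open>|z m|^k m\<close> once finitely many \<open>m\<close> are removed from \<open>C\<close>; so the sum of
  \<open>k m * - ln |z m|\<close> over \<open>C\<close> is finite, and it stays finite after multiplication by suitable weights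
  that tend to infinity (\<open>exists_weights_preserving_summability\<close>).

  The naive product of the powers of \<open>1 - X / z m\<close> has bounded partial products, but its coefficients
  need not converge, because \<open>|z m|\<close> tends to 1. Each linear factor is therefore replaced by
  \<open>1 - W^q * (1 + c * (W - 1))\<close> with \<open>W = X / z m\<close>, which still vanishes at \<open>z m\<close> but is 1 up to order \<open>q\<close>.
  If the orders \<open>q m\<close> tend to infinity, every coefficient of the partial products is eventually
  constant; if they do so slowly, the weighted sum keeps the coefficients bounded
  (\<open>exists_infinite_product\<close>, \<open>exists_product_with_zeros\<close>).

  With multiplicities \<open>c m * k m\<close>, where \<open>c m\<close> tends to infinity slowly, the product is at most a constant
  times \<open>r^c n\<close> on the disk around \<open>z n\<close>; it is an element of the kernel with constant
  coefficient 1. With multiplicities \<open>k m\<close>, the product \<open>g\<close> vanishes at each \<open>z n\<close>. The new factors have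
  further zeros, but since the residue field is infinite the constants \<open>c\<close> can be chosen so that these
  zeros stay at distance at least \<open>|z m|\<close> from one chosen point in each of the disks
  (\<open>exists_separating_coefficient\<close>). At these points \<open>g\<close> is bounded below, so \<open>g\<close> is not in the kernel.
  But \<open>g\<close> is in the ideal of series whose values at \<open>z n\<close> tend to 0 along \<open>u\<close>, which contains the kernel
  and does not contain 1. So the kernel is not maximal.
\<close>

section \<open>Nonarchimedean absolute values\<close>

lemma absval_eq_dist_0: "absval x = dist x 0"
  by (simp add: dist_absval)

lemma absval_nonneg [simp]: "0 \<le> absval x"
  by (simp add: absval_eq_dist_0)

lemma absval_eq_0_iff [simp]: "absval x = 0 \<longleftrightarrow> x = 0"
  by (simp add: absval_eq_dist_0)

lemma absval_pos_iff [simp]: "0 < absval x \<longleftrightarrow> x \<noteq> 0"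
  by (simp add: absval_eq_dist_0)

lemma absval_0 [simp]: "absval 0 = 0"
  by simp

lemma absval_1 [simp]: "absval 1 = 1"
  using absval_mult[of 1 1] absval_eq_0_iff[of 1] by auto

lemma absval_minus_commute: "absval (x - y) = absval (y - x)"
  by (metis dist_absval dist_commute)

lemma absval_minus [simp]: "absval (- x) = absval x"
  using absval_minus_commute[of 0 x] by simp

lemma absval_power: "absval (x ^ n) = absval x ^ n"
  by (induction n) (simp_all add: absval_mult)

lemma absval_prod: "absval (prod f S) = (\<Prod>i\<in>S. absval (f i))"
  by (induction S rule: infinite_finite_induct) (simp_all add: absval_mult)

lemma absval_inverse: "absval (inverse x) = inverse (absval x)"
proof (cases "x = 0")
  case False
  then have "absval x * absval (inverse x) = 1"
    by (simp flip: absval_mult)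
  then show ?thesis
    using inverse_unique by metis
qed simp

lemma absval_divide: "absval (x / y) = absval x / absval y"
  by (simp add: divide_inverse absval_mult absval_inverse)

lemma absval_add_le: "\<lbrakk>absval x \<le> b; absval y \<le> b\<rbrakk> \<Longrightarrow> absval (x + y) \<le> b"
  using absval_add[of x y] by simp

lemma absval_diff_le: "\<lbrakk>absval x \<le> b; absval y \<le> b\<rbrakk> \<Longrightarrow> absval (x - y) \<le> b"
  using absval_add_le[of x b "- y"] by simp

lemma absval_add_less: "\<lbrakk>absval x < b; absval y < b\<rbrakk> \<Longrightarrow> absval (x + y) < b"
  using absval_add[of x y] by simp

lemma absval_diff_less: "\<lbrakk>absval x < b; absval y < b\<rbrakk> \<Longrightarrow> absval (x - y) < b"
  using absval_add_less[of x b "- y"] by simp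

lemma absval_add_eq_right:
  assumes "absval x < absval y"
  shows "absval (x + y) = absval y"
proof (rule antisym)
  show "absval (x + y) \<le> absval y"
    using assms by (intro absval_add_le) auto
  show "absval y \<le> absval (x + y)"
  proof (rule ccontr)
    assume "\<not> absval y \<le> absval (x + y)"
    then have "absval ((x + y) - x) < absval y"
      using assms by (intro absval_diff_less) auto
    then show False by simp
  qed
qed

lemma absval_sum_le:
  assumes "\<And>i. i \<in> S \<Longrightarrow> absval (f i) \<le> b" "0 \<le> b"
  shows "absval (sum f S) \<le> b"
  using assms by (induction S rule: infinite_finite_induct) (auto intro: absval_add_le)

lemma absval_sum_less:
  assumes "\<And>i. i \<in> S \<Longrightarrow> absval (f i) < b" "0 < b"
  shows "absval (sum f S) < b"
  using assms by (induction S rule: infinite_finite_induct) (auto intro: absval_add_less)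

lemma exists_small_absval:
  assumes "0 < e"
  shows "\<exists>a::'a::nonarch_valued_field. a \<noteq> 0 \<and> absval a < e"
proof -
  obtain x :: 'a where x: "x \<noteq> 0" "absval x < 1"
  proof -
    obtain x :: 'a where x: "x \<noteq> 0" "absval x \<noteq> 1"
      using absval_nontrivial by blast
    show thesis
    proof (cases "absval x < 1")
      case False
      then have "absval (inverse x) < 1"
        using x by (simp only: absval_inverse) (auto intro: inverse_less_1_iff[THEN iffD2])
      then show thesis
        using that[of "inverse x"] x by simp
    qed (use x that in auto)
  qed
  obtain n where "absval x ^ n < e"
    using real_arch_pow_inv[OF assms x(2)] by blast
  then show ?thesis
    using x by (intro exI[of _ "x ^ n"]) (auto simp: absval_power)
qed

lemma mem_ball_0_iff_absval: "x \<in> ball 0 1 \<longleftrightarrow> absval x < 1"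
  for x :: "'a::nonarch_valued_field"
  by (simp add: dist_absval)

lemma mem_cball_iff_absval: "x \<in> cball c r \<longleftrightarrow> absval (x - c) \<le> r"
  for x c :: "'a::nonarch_valued_field"
  by (simp add: dist_absval absval_minus_commute)

lemma tendsto_absval:
  "(f \<longlongrightarrow> l) F \<Longrightarrow> ((\<lambda>n. absval (f n)) \<longlongrightarrow> absval l) F"
  for f :: "_ \<Rightarrow> 'a::nonarch_valued_field"
  unfolding absval_eq_dist_0 by (intro tendsto_intros)

lemma tendsto_absval_iff:
  "(f \<longlongrightarrow> l) F \<longleftrightarrow> ((\<lambda>n. absval (f n - l)) \<longlongrightarrow> 0) F"
  for f :: "_ \<Rightarrow> 'a::nonarch_valued_field"
  by (subst tendsto_dist_iff) (simp add: dist_absval)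

text \<open>
  The residue field of an algebraically closed field is infinite. A direct argument: any root \<open>c\<close> of
  the equation \<open>\<Prod>(c - t) = 1\<close>, where \<open>t\<close> runs over 0 and the elements of \<open>T\<close> in the closed unit disk,
  is in the closed unit disk as well. So all factors have absolute value at most 1, and as their product
  is 1, each of them has absolute value 1. Elements of \<open>T\<close> outside the closed unit disk are at distance
  greater than 1 from \<open>c\<close>.
\<close>

lemma exists_avoiding_residue_classes:
  fixes T :: "'a::complete_alg_closed_nonarch_field set"
  assumes "finite T"
  shows "\<exists>c. absval c = 1 \<and> (\<forall>t\<in>T. 1 \<le> absval (c - t))"
proof -
  define U where "U = insert 0 {t \<in> T. absval t \<le> 1}"
  have U: "finite U" "0 \<in> U" "\<And>t. t \<in> U \<Longrightarrow> absval t \<le> 1"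
    using assms by (auto simp: U_def)
  define p where "p = (\<Prod>t\<in>U. [:- t, 1:]) - 1"
  have "degree (\<Prod>t\<in>U. [:- t, 1:]) = card U"
    by (subst degree_prod_eq_sum_degree) auto
  moreover have "card U > 0"
    using U by (auto simp: card_gt_0_iff)
  ultimately have "degree p > 0"
    using degree_add_eq_left[of "- 1" "\<Prod>t\<in>U. [:- t, 1:]"] by (simp add: p_def)
  then obtain c where "poly p c = 0"
    using alg_closed_imp_poly_has_root[of p] by auto
  then have prod1: "(\<Prod>t\<in>U. absval (c - t)) = 1"
    by (simp add: p_def poly_prod flip: absval_prod)
  have c_le: "absval c \<le> 1"
  proof (rule ccontr)
    assume c: "\<not> absval c \<le> 1"
    have "absval (c - t) = absval c" if "t \<in> U" for t
      using absval_add_eq_right[of "- t" c] U(3)[OF that] c by simp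
    then have "(\<Prod>t\<in>U. absval (c - t)) = absval c ^ card U"
      by simp
    also have "\<dots> > 1"
      using c \<open>card U > 0\<close> by (intro one_less_power) auto
    finally show False using prod1 by simp
  qed
  have U1: "1 \<le> absval (c - t)" if "t \<in> U" for t
  proof -
    have "(\<Prod>t\<in>U - {t}. absval (c - t)) \<le> 1"
      using U c_le by (intro prod_le_1) (auto intro: absval_diff_le)
    moreover have "absval (c - t) * (\<Prod>t\<in>U - {t}. absval (c - t)) = 1"
      using prod1 prod.remove[OF U(1) that, of "\<lambda>t. absval (c - t)"] by simp
    ultimately show ?thesis
      by (metis absval_nonneg mult.right_neutral mult_left_mono)
  qed
  have "1 \<le> absval (c - t)" if t: "t \<in> T" for t
  proof (cases "absval t \<le> 1")
    case False
    then have "absval (c - t) = absval t"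
      using absval_add_eq_right[of c "- t"] c_le by simp
    then show ?thesis using False by simp
  qed (use t U1 in \<open>auto simp: U_def\<close>)
  moreover have "absval c = 1"
    using U1[OF U(2)] c_le by simp
  ultimately show ?thesis by blast
qed

section \<open>Bounded power series and their values\<close>

text \<open>
  The Gauss norm of \<open>f\<close> is at most \<open>A\<close>. A predicate is more convenient than the norm as a supremum, since
  its rules below need no separate proof that the series involved are bounded.
\<close>

definition coeffs_le :: "'a::nonarch_valued_field fps \<Rightarrow> real \<Rightarrow> bool" where
  "coeffs_le f A \<longleftrightarrow> (\<forall>n. absval (fps_nth f n) \<le> A)"

lemma coeffs_leD: "coeffs_le f A \<Longrightarrow> absval (fps_nth f n) \<le> A"
  by (simp add: coeffs_le_def)

lemma coeffs_le_nonneg: "coeffs_le f A \<Longrightarrow> 0 \<le> A"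
  by (meson absval_nonneg coeffs_leD order_trans)

lemma coeffs_le_mono: "coeffs_le f A \<Longrightarrow> A \<le> B \<Longrightarrow> coeffs_le f B"
  by (meson coeffs_le_def order_trans)

lemma coeffs_le_const: "coeffs_le (fps_const c) (absval c)"
  by (simp add: coeffs_le_def)

lemma coeffs_le_1: "coeffs_le 1 1"
  by (simp add: coeffs_le_def)

lemma coeffs_le_X: "coeffs_le fps_X 1"
  by (simp add: coeffs_le_def fps_X_def)

lemma coeffs_le_add: "coeffs_le f A \<Longrightarrow> coeffs_le g A \<Longrightarrow> coeffs_le (f + g) A"
  by (simp add: coeffs_le_def absval_add_le)

lemma coeffs_le_diff: "coeffs_le f A \<Longrightarrow> coeffs_le g A \<Longrightarrow> coeffs_le (f - g) A"
  by (simp add: coeffs_le_def absval_diff_le)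

lemma coeffs_le_minus: "coeffs_le f A \<Longrightarrow> coeffs_le (- f) A"
  by (simp add: coeffs_le_def)

lemma coeffs_le_mult: "coeffs_le f A \<Longrightarrow> coeffs_le g B \<Longrightarrow> coeffs_le (f * g) (A * B)"
  unfolding coeffs_le_def fps_mult_nth
  by (intro allI absval_sum_le)
     (auto simp: absval_mult intro!: mult_mono mult_nonneg_nonneg
       intro: order_trans[OF absval_nonneg])

lemma coeffs_le_power: "coeffs_le f A \<Longrightarrow> coeffs_le (f ^ n) (A ^ n)"
  by (induction n) (simp_all add: coeffs_le_1 coeffs_le_mult)

lemma coeffs_le_prod:
  "(\<And>i. i \<in> S \<Longrightarrow> coeffs_le (f i) (A i)) \<Longrightarrow> coeffs_le (prod f S) (prod A S)"
  by (induction S rule: infinite_finite_induct) (simp_all add: coeffs_le_1 coeffs_le_mult)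

lemma carrier_Hinf_iff: "f \<in> carrier Hinf \<longleftrightarrow> (\<exists>A. coeffs_le f A)"
  unfolding Hinf_def coeffs_le_def
  by (simp add: bounded_any_center[of _ 0] dist_absval)

lemma cring_Hinf: "cring (Hinf :: 'a::nonarch_valued_field fps ring)"
proof (rule cringI)
  show "abelian_group (Hinf :: 'a fps ring)"
  proof (rule abelian_groupI)
    fix f g :: "'a fps"
    assume "f \<in> carrier Hinf" "g \<in> carrier Hinf"
    then obtain A B where "coeffs_le f A" "coeffs_le g B"
      by (auto simp: carrier_Hinf_iff)
    then have "coeffs_le (f + g) (max A B)"
      by (intro coeffs_le_add) (auto elim: coeffs_le_mono)
    then show "f \<oplus>\<^bsub>Hinf\<^esub> g \<in> carrier Hinf"
      unfolding carrier_Hinf_iff by (auto simp: Hinf_def)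
  next
    fix f :: "'a fps"
    assume "f \<in> carrier Hinf"
    then have "- f \<in> carrier Hinf"
      unfolding carrier_Hinf_iff by (auto intro: coeffs_le_minus)
    then show "\<exists>g\<in>carrier Hinf. g \<oplus>\<^bsub>Hinf\<^esub> f = \<zero>\<^bsub>Hinf\<^esub>"
      by (intro bexI[of _ "- f"]) (auto simp: Hinf_def)
  qed (auto simp: Hinf_def)
  show "comm_monoid (Hinf :: 'a fps ring)"
  proof (rule comm_monoidI)
    fix f g :: "'a fps"
    assume "f \<in> carrier Hinf" "g \<in> carrier Hinf"
    then show "f \<otimes>\<^bsub>Hinf\<^esub> g \<in> carrier Hinf"
      unfolding carrier_Hinf_iff by (auto simp: Hinf_def intro: coeffs_le_mult)
  next
    show "\<one>\<^bsub>Hinf\<^esub> \<in> carrier (Hinf :: 'a fps ring)"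
      unfolding carrier_Hinf_iff by (auto simp: Hinf_def intro: coeffs_le_1)
  qed (auto simp: Hinf_def)
qed (auto simp: Hinf_def algebra_simps)

lemma partial_sums_diff_le:
  fixes z :: "'a::nonarch_valued_field"
  assumes "coeffs_le f A" "absval z < 1" "N \<le> m" "N \<le> n"
  shows "absval ((\<Sum>i<m. fps_nth f i * z ^ i) - (\<Sum>i<n. fps_nth f i * z ^ i))
           \<le> A * absval z ^ N"
  using assms(3,4)
proof (induction m n rule: linorder_wlog)
  case (le m n)
  have "(\<Sum>i<n. fps_nth f i * z ^ i)
      = (\<Sum>i<m. fps_nth f i * z ^ i) + (\<Sum>i\<in>{m..<n}. fps_nth f i * z ^ i)"
    using sum.atLeastLessThan_concat[of 0 m n "\<lambda>i. fps_nth f i * z ^ i"] le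
    by (simp add: atLeast0LessThan)
  moreover have "absval (\<Sum>i\<in>{m..<n}. fps_nth f i * z ^ i) \<le> A * absval z ^ N"
  proof (rule absval_sum_le)
    fix i assume "i \<in> {m..<n}"
    then have "absval z ^ i \<le> absval z ^ N"
      using le assms by (intro power_decreasing) auto
    then show "absval (fps_nth f i * z ^ i) \<le> A * absval z ^ N"
      using coeffs_le_nonneg[OF assms(1)]
      by (auto simp: absval_mult absval_power intro!: mult_mono coeffs_leD assms)
  qed (use coeffs_le_nonneg[OF assms(1)] in simp)
  ultimately show ?case
    by simp
next
  case (sym m n)
  then show ?case
    by (simp add: absval_minus_commute)
qed

text \<open>
  By the ultrametric inequality a tail of the series is bounded by its largest term. The explicit
  error term makes all rules for \<open>ps_eval\<close> statements about finite sums.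
\<close>

lemma ps_eval_approx:
  fixes z :: "'a::{nonarch_valued_field, complete_space}"
  assumes f: "coeffs_le f A" and z: "absval z < 1"
  shows "absval (ps_eval f z - (\<Sum>i<N. fps_nth f i * z ^ i)) \<le> A * absval z ^ N"
proof -
  define S where "S n = (\<Sum>i<n. fps_nth f i * z ^ i)" for n
  have S: "absval (S m - S n) \<le> A * absval z ^ N" if "N \<le> m" "N \<le> n" for m n N
    unfolding S_def using partial_sums_diff_le[OF f z that] .
  have null: "(\<lambda>N. A * absval z ^ N) \<longlonglongrightarrow> 0"
    using z by (intro tendsto_mult_right_zero LIMSEQ_realpow_zero) auto
  have "Cauchy S"
  proof (rule metric_CauchyI)
    fix e :: real assume "e > 0"
    then obtain N where "A * absval z ^ N < e"
      using order_tendstoD(2)[OF null] eventually_happens'[of sequentially]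
      by (metis sequentially_bot)
    then show "\<exists>N. \<forall>m\<ge>N. \<forall>n\<ge>N. dist (S m) (S n) < e"
      using S unfolding dist_absval by (meson le_less_trans)
  qed
  then obtain L where L: "S \<longlonglongrightarrow> L"
    using Cauchy_convergent convergent_def by blast
  then have "(\<lambda>i. fps_nth f i * z ^ i) sums L"
    by (simp add: sums_def S_def[abs_def])
  then have "ps_eval f z = L"
    by (simp add: ps_eval_def sums_iff)
  moreover have "(\<lambda>m. dist (S m) (S N)) \<longlonglongrightarrow> dist L (S N)"
    by (intro tendsto_intros L)
  then have "dist L (S N) \<le> A * absval z ^ N"
    by (rule LIMSEQ_le_const2) (auto simp: dist_absval intro!: exI[of _ N] S)
  ultimately show ?thesis
    by (simp add: dist_absval S_def)
qed

lemma ps_eval_eqI: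
  fixes z :: "'a::{nonarch_valued_field, complete_space}"
  assumes f: "coeffs_le f A" and z: "absval z < 1"
    and v: "\<And>N. absval (v - (\<Sum>i<N. fps_nth f i * z ^ i)) \<le> B * absval z ^ N"
  shows "ps_eval f z = v"
proof -
  have "absval (ps_eval f z - v) \<le> max A B * absval z ^ N" for N
  proof -
    let ?S = "\<Sum>i<N. fps_nth f i * z ^ i"
    have *: "x * absval z ^ N \<le> max A B * absval z ^ N" if "x \<le> max A B" for x
      using that by (intro mult_right_mono) auto
    have "absval ((ps_eval f z - ?S) - (v - ?S)) \<le> max A B * absval z ^ N"
      by (intro absval_diff_le order_trans[OF ps_eval_approx[OF f z] *] order_trans[OF v *]) auto
    then show ?thesis by simp
  qed
  moreover have "(\<lambda>N. max A B * absval z ^ N) \<longlonglongrightarrow> 0"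
    using z by (intro tendsto_mult_right_zero LIMSEQ_realpow_zero) auto
  ultimately have "absval (ps_eval f z - v) \<le> 0"
    by (intro LIMSEQ_le_const) auto
  then show ?thesis
    using absval_nonneg[of "ps_eval f z - v"] by (simp add: order_antisym_conv)
qed

lemma absval_ps_eval_le:
  fixes z :: "'a::{nonarch_valued_field, complete_space}"
  assumes "coeffs_le f A" "absval z < 1"
  shows "absval (ps_eval f z) \<le> A"
  using ps_eval_approx[OF assms, of 0] by simp

lemma ps_eval_const:
  fixes z :: "'a::{nonarch_valued_field, complete_space}"
  assumes "absval z < 1"
  shows "ps_eval (fps_const c) z = c"
proof (rule ps_eval_eqI[OF coeffs_le_const assms])
  fix N
  have "(\<Sum>i<N. fps_nth (fps_const c) i * z ^ i) = (\<Sum>i<N. if i = 0 then c else 0)"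
    by (intro sum.cong) auto
  then show "absval (c - (\<Sum>i<N. fps_nth (fps_const c) i * z ^ i)) \<le> absval c * absval z ^ N"
    by (cases N) (auto simp: sum.delta)
qed

lemma ps_eval_1 [simp]:
  fixes z :: "'a::{nonarch_valued_field, complete_space}"
  shows "absval z < 1 \<Longrightarrow> ps_eval 1 z = 1"
  using ps_eval_const[of z 1] by simp

lemma ps_eval_X:
  fixes z :: "'a::{nonarch_valued_field, complete_space}"
  assumes "absval z < 1"
  shows "ps_eval fps_X z = z"
proof (rule ps_eval_eqI[OF coeffs_le_X assms])
  fix N
  have "(\<Sum>i<N. fps_nth fps_X i * z ^ i) = (\<Sum>i<N. if i = 1 then z else 0)"
    by (intro sum.cong) (auto simp: fps_X_def)
  then show "absval (z - (\<Sum>i<N. fps_nth fps_X i * z ^ i)) \<le> 1 * absval z ^ N"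
    using assms by (cases "N > 1") (auto simp: sum.delta not_less le_Suc_eq)
qed

lemma ps_eval_add:
  fixes z :: "'a::{nonarch_valued_field, complete_space}"
  assumes f: "coeffs_le f A" and g: "coeffs_le g B" and z: "absval z < 1"
  shows "ps_eval (f + g) z = ps_eval f z + ps_eval g z"
proof -
  have f': "coeffs_le f (max A B)" and g': "coeffs_le g (max A B)"
    using f g by (auto elim: coeffs_le_mono)
  show ?thesis
  proof (rule ps_eval_eqI[OF coeffs_le_add[OF f' g'] z])
    fix N
    have "absval ((ps_eval f z - (\<Sum>i<N. fps_nth f i * z ^ i))
             + (ps_eval g z - (\<Sum>i<N. fps_nth g i * z ^ i))) \<le> max A B * absval z ^ N"
      by (intro absval_add_le ps_eval_approx f' g' z)
    then show "absval (ps_eval f z + ps_eval g z - (\<Sum>i<N. fps_nth (f + g) i * z ^ i))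
        \<le> max A B * absval z ^ N"
      by (simp add: algebra_simps sum.distrib)
  qed
qed

text \<open>
  The product of the two partial sums differs from the partial sum of the Cauchy product only in terms
  of degree at least \<open>N\<close>, and these are at most \<open>A * B * absval z ^ N\<close>.
\<close>

lemma ps_eval_mult:
  fixes z :: "'a::{nonarch_valued_field, complete_space}"
  assumes f: "coeffs_le f A" and g: "coeffs_le g B" and z: "absval z < 1"
  shows "ps_eval (f * g) z = ps_eval f z * ps_eval g z"
proof (rule ps_eval_eqI[OF coeffs_le_mult[OF f g] z])
  fix N
  let ?S = "\<lambda>h. \<Sum>i<N. fps_nth h i * z ^ i" and ?t = "absval z ^ N"
  have A: "0 \<le> A" and B: "0 \<le> B"
    using f g by (auto dest: coeffs_le_nonneg)
  let ?T = "{(i, j). i + j < N}" and ?Q = "{..<N} \<times> {..<N}"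
  let ?c = "\<lambda>(i, j). fps_nth f i * z ^ i * (fps_nth g j * z ^ j)"
  have TQ: "?T \<subseteq> ?Q" "finite ?Q"
    by auto
  have "?S (f * g) = (\<Sum>k<N. \<Sum>i\<le>k. ?c (i, k - i))"
    unfolding fps_mult_nth sum_distrib_right atLeast0AtMost
    by (intro sum.cong refl) (auto simp: power_add[symmetric] mult_ac)
  also have "\<dots> = sum ?c ?T"
    using sum.triangle_reindex[of "\<lambda>i j. ?c (i, j)" N] by (simp add: case_prod_unfold)
  finally have prod: "?S (f * g) = sum ?c ?T" .
  have "?S f * ?S g = sum ?c ?Q"
    by (simp add: sum_product sum.cartesian_product)
  also have "\<dots> = sum ?c (?Q - ?T) + sum ?c ?T"
    using TQ by (intro sum.subset_diff) auto
  finally have SS: "?S f * ?S g - ?S (f * g) = sum ?c (?Q - ?T)"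
    using prod by simp
  have 1: "absval (?S f * ?S g - ?S (f * g)) \<le> A * B * ?t"
    unfolding SS
  proof (rule absval_sum_le)
    fix p assume p: "p \<in> ?Q - ?T"
    obtain i j where ij: "p = (i, j)" by (cases p)
    have "absval (?c p) = absval (fps_nth f i) * absval (fps_nth g j) * absval z ^ (i + j)"
      by (simp add: ij absval_mult absval_power power_add)
    also have "\<dots> \<le> A * B * ?t"
      using p z A B ij
      by (intro mult_mono coeffs_leD[OF f] coeffs_leD[OF g] power_decreasing) auto
    finally show "absval (?c p) \<le> A * B * ?t" .
  qed (use A B in simp)
  have 2: "absval ((ps_eval f z - ?S f) * ps_eval g z) \<le> A * B * ?t"
  proof -
    have "absval (ps_eval f z - ?S f) * absval (ps_eval g z) \<le> (A * ?t) * B"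
      using A B by (intro mult_mono ps_eval_approx absval_ps_eval_le f g z) auto
    then show ?thesis by (simp add: absval_mult mult_ac)
  qed
  have Sf: "absval (?S f) \<le> A"
  proof (intro absval_sum_le A)
    fix i
    have "absval (fps_nth f i) * absval z ^ i \<le> A * 1"
      using A z by (intro mult_mono coeffs_leD[OF f] power_le_one) auto
    then show "absval (fps_nth f i * z ^ i) \<le> A"
      by (simp add: absval_mult absval_power)
  qed
  have 3: "absval (?S f * (ps_eval g z - ?S g)) \<le> A * B * ?t"
  proof -
    have "absval (?S f) * absval (ps_eval g z - ?S g) \<le> A * (B * ?t)"
      using A B by (intro mult_mono ps_eval_approx Sf g z) auto
    then show ?thesis by (simp add: absval_mult mult_ac)
  qed
  have "ps_eval f z * ps_eval g z - ?S (f * g)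
      = (ps_eval f z - ?S f) * ps_eval g z + (?S f * (ps_eval g z - ?S g)
          + (?S f * ?S g - ?S (f * g)))"
    by (simp add: algebra_simps)
  also have "absval \<dots> \<le> A * B * ?t"
    by (intro absval_add_le 1 2 3)
  finally show "absval (ps_eval f z * ps_eval g z - ?S (f * g)) \<le> A * B * ?t" .
qed

lemma ps_eval_minus:
  fixes z :: "'a::{nonarch_valued_field, complete_space}"
  assumes f: "coeffs_le f A" and z: "absval z < 1"
  shows "ps_eval (- f) z = - ps_eval f z"
proof -
  have "fps_const (- 1) * f = - f"
    by (metis fps_const_1_eq_1 fps_const_neg mult_minus1)
  then show ?thesis
    using ps_eval_mult[OF coeffs_le_const[of "- 1"] f z] ps_eval_const[OF z, of "- 1"] by simp
qed

lemma ps_eval_diff: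
  fixes z :: "'a::{nonarch_valued_field, complete_space}"
  assumes f: "coeffs_le f A" and g: "coeffs_le g B" and z: "absval z < 1"
  shows "ps_eval (f - g) z = ps_eval f z - ps_eval g z"
  using ps_eval_add[OF f coeffs_le_minus[OF g] z] ps_eval_minus[OF g z] by simp

lemma ps_eval_power:
  fixes z :: "'a::{nonarch_valued_field, complete_space}"
  assumes f: "coeffs_le f A" and z: "absval z < 1"
  shows "ps_eval (f ^ n) z = ps_eval f z ^ n"
  by (induction n) (simp_all add: z ps_eval_mult[OF f coeffs_le_power[OF f] z])

lemma ps_eval_prod:
  fixes z :: "'a::{nonarch_valued_field, complete_space}"
  assumes f: "\<And>i. i \<in> S \<Longrightarrow> coeffs_le (f i) (A i)" and z: "absval z < 1"
  shows "ps_eval (prod f S) z = (\<Prod>i\<in>S. ps_eval (f i) z)"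
  using f
proof (induction S rule: infinite_finite_induct)
  case (insert i S)
  have "ps_eval (f i * prod f S) z = ps_eval (f i) z * ps_eval (prod f S) z"
    by (rule ps_eval_mult[OF _ coeffs_le_prod z]) (use insert.prems in auto)
  then show ?case
    using insert by simp
qed (simp_all add: z)

lemma ps_eval_cong_order:
  fixes z :: "'a::{nonarch_valued_field, complete_space}"
  assumes f: "coeffs_le f A" and g: "coeffs_le g A" and z: "absval z < 1"
    and eq: "\<And>i. i < N \<Longrightarrow> fps_nth f i = fps_nth g i"
  shows "absval (ps_eval f z - ps_eval g z) \<le> A * absval z ^ N"
proof -
  have "(\<Sum>i<N. fps_nth (f - g) i * z ^ i) = 0"
    by (intro sum.neutral) (simp add: eq)
  then show ?thesis
    using ps_eval_approx[OF coeffs_le_diff[OF f g] z, of N] ps_eval_diff[OF f g z] by simp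
qed

section \<open>Ideals of functions that tend to zero along a filter\<close>

lemma bdd_above_ps_eval:
  fixes D :: "'a::{nonarch_valued_field, complete_space} set"
  assumes "D \<subseteq> ball 0 1" "coeffs_le f A"
  shows "bdd_above ((\<lambda>z. absval (ps_eval f z)) ` D)"
  using assms
  by (intro bdd_aboveI2[of _ _ A] absval_ps_eval_le) (auto simp: mem_ball_0_iff_absval subset_iff simp del: mem_ball)

lemma absval_le_zeta_disk:
  fixes D :: "'a::{nonarch_valued_field, complete_space} set"
  assumes "D \<subseteq> ball 0 1" "coeffs_le f A" "z \<in> D"
  shows "absval (ps_eval f z) \<le> zeta_disk D f"
  unfolding zeta_disk_def by (intro cSUP_upper assms bdd_above_ps_eval[OF assms(1,2)])

lemma zeta_disk_leI:
  assumes "D \<noteq> {}" "\<And>z. z \<in> D \<Longrightarrow> absval (ps_eval f z) \<le> b"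
  shows "zeta_disk D f \<le> b"
  unfolding zeta_disk_def by (intro cSUP_least assms)

lemma zeta_disk_nonneg:
  fixes D :: "'a::{nonarch_valued_field, complete_space} set"
  assumes "D \<noteq> {}" "D \<subseteq> ball 0 1" "coeffs_le f A"
  shows "0 \<le> zeta_disk D f"
proof -
  obtain z where "z \<in> D"
    using assms by blast
  then show ?thesis
    using absval_le_zeta_disk[OF assms(2,3)] absval_nonneg order_trans by blast
qed

text \<open>
  The disks \<open>D n\<close> of a point of \<open>M1\<close> give its kernel, and the singletons \<open>D n = {z n}\<close> give the larger ideal
  that shows that the kernel is not maximal.
\<close>

definition null_ideal ::
    "(nat \<Rightarrow> 'a::nonarch_valued_field set) \<Rightarrow> nat filter \<Rightarrow> 'a fps set" where
  "null_ideal D u = {f \<in> carrier Hinf. ((\<lambda>n. zeta_disk (D n) f) \<longlongrightarrow> 0) u}"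

lemma null_idealI:
  fixes D :: "nat \<Rightarrow> 'a::{nonarch_valued_field, complete_space} set"
  assumes D: "\<And>n. D n \<noteq> {}" "\<And>n. D n \<subseteq> ball 0 1"
    and f: "coeffs_le f A"
    and h: "\<forall>\<^sub>F n in u. \<forall>z\<in>D n. absval (ps_eval f z) \<le> h n" "(h \<longlongrightarrow> 0) u"
  shows "f \<in> null_ideal D u"
proof -
  have "((\<lambda>n. zeta_disk (D n) f) \<longlongrightarrow> 0) u"
  proof (rule tendsto_sandwich[OF _ _ tendsto_const h(2)])
    show "\<forall>\<^sub>F n in u. zeta_disk (D n) f \<le> h n"
      using h(1) by (rule eventually_mono) (blast intro: zeta_disk_leI[OF D(1)])
  qed (use zeta_disk_nonneg[OF D f] in simp)
  then show ?thesis
    using f by (auto simp: null_ideal_def carrier_Hinf_iff)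
qed

lemma ideal_null_ideal:
  fixes D :: "nat \<Rightarrow> 'a::{nonarch_valued_field, complete_space} set"
  assumes D: "\<And>n. D n \<noteq> {}" "\<And>n. D n \<subseteq> ball 0 1"
  shows "ideal (null_ideal D u) Hinf"
proof -
  interpret H: cring "Hinf :: 'a fps ring"
    by (rule cring_Hinf)
  have D1: "absval z < 1" if "z \<in> D n" for z n
    using that D(2)[of n] by (auto simp: dist_absval)
  have absorb: "a * f \<in> null_ideal D u" if f: "f \<in> null_ideal D u" and a: "a \<in> carrier Hinf" for a f
  proof -
    obtain A B where A: "coeffs_le a A" and B: "coeffs_le f B"
      using a f by (auto simp: null_ideal_def carrier_Hinf_iff)
    show ?thesis
    proof (rule null_idealI[OF D coeffs_le_mult[OF A B]])
      show "((\<lambda>n. A * zeta_disk (D n) f) \<longlongrightarrow> 0) u"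
        using f by (intro tendsto_mult_right_zero) (simp add: null_ideal_def)
      have "absval (ps_eval (a * f) z) \<le> A * zeta_disk (D n) f" if z: "z \<in> D n" for n z
        unfolding ps_eval_mult[OF A B D1[OF z]] absval_mult
        using D1[OF z] coeffs_le_nonneg[OF A]
        by (intro mult_mono absval_ps_eval_le[OF A] absval_le_zeta_disk[OF D(2) B z]) auto
      then show "\<forall>\<^sub>F n in u. \<forall>z\<in>D n. absval (ps_eval (a * f) z) \<le> A * zeta_disk (D n) f"
        by auto
    qed
  qed
  have add: "f + g \<in> null_ideal D u" if f: "f \<in> null_ideal D u" and g: "g \<in> null_ideal D u" for f g
  proof -
    obtain A B where A: "coeffs_le f A" and B: "coeffs_le g B"
      using f g by (auto simp: null_ideal_def carrier_Hinf_iff)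
    have fg: "coeffs_le (f + g) (max A B)"
      using A B by (intro coeffs_le_add) (auto elim: coeffs_le_mono)
    show ?thesis
    proof (rule null_idealI[OF D fg])
      have "((\<lambda>n. max (zeta_disk (D n) f) (zeta_disk (D n) g)) \<longlongrightarrow> max 0 0) u"
        using f g by (intro tendsto_max) (auto simp: null_ideal_def)
      then show "((\<lambda>n. max (zeta_disk (D n) f) (zeta_disk (D n) g)) \<longlongrightarrow> 0) u"
        by simp
      have "absval (ps_eval (f + g) z) \<le> max (zeta_disk (D n) f) (zeta_disk (D n) g)"
        if z: "z \<in> D n" for n z
        unfolding ps_eval_add[OF A B D1[OF z]]
        using absval_le_zeta_disk[OF D(2) A z] absval_le_zeta_disk[OF D(2) B z]
        by (intro absval_add_le) auto
      then show "\<forall>\<^sub>F n in u. \<forall>z\<in>D n.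
          absval (ps_eval (f + g) z) \<le> max (zeta_disk (D n) f) (zeta_disk (D n) g)"
        by auto
    qed
  qed
  have "0 \<in> null_ideal D u"
  proof (rule null_idealI[OF D coeffs_le_const[of 0, simplified]])
    show "\<forall>\<^sub>F n in u. \<forall>z\<in>D n. absval (ps_eval 0 z) \<le> 0"
      using ps_eval_const[OF D1, of _ _ 0] by (auto intro!: always_eventually)
  qed simp
  have "subgroup (null_ideal D u) (add_monoid Hinf)"
  proof (intro H.add.subgroupI)
    show "null_ideal D u \<noteq> {}"
      using \<open>0 \<in> null_ideal D u\<close> by blast
  next
    fix f assume f: "f \<in> null_ideal D u"
    have "- f = (- 1) * f" "- 1 \<in> carrier (Hinf :: 'a fps ring)"
      unfolding carrier_Hinf_iff using coeffs_le_minus[OF coeffs_le_1] by auto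
    then have "- f \<in> null_ideal D u"
      using absorb[OF f, of "- 1"] by metis
    moreover have "\<ominus>\<^bsub>Hinf\<^esub> f = - f"
    proof (rule H.minus_equality)
      show "f \<in> carrier Hinf" "- f \<in> carrier Hinf"
        using f \<open>- f \<in> null_ideal D u\<close> by (auto simp: null_ideal_def)
    qed (simp add: Hinf_def)
    ultimately show "\<ominus>\<^bsub>Hinf\<^esub> f \<in> null_ideal D u"
      by simp
  next
    show "null_ideal D u \<subseteq> carrier Hinf"
      by (auto simp: null_ideal_def)
  next
    fix f g assume "f \<in> null_ideal D u" "g \<in> null_ideal D u"
    then have "f + g \<in> null_ideal D u"
      by (rule add)
    then show "f \<oplus>\<^bsub>Hinf\<^esub> g \<in> null_ideal D u"
      by (simp add: Hinf_def)
  qed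
  then show ?thesis
  proof (rule idealI[OF H.ring_axioms])
    fix a f :: "'a fps"
    assume "a \<in> null_ideal D u" "f \<in> carrier Hinf"
    then have "f * a \<in> null_ideal D u"
      by (rule absorb)
    then show "f \<otimes>\<^bsub>Hinf\<^esub> a \<in> null_ideal D u" "a \<otimes>\<^bsub>Hinf\<^esub> f \<in> null_ideal D u"
      by (simp_all add: Hinf_def mult.commute[of a f])
  qed
qed


section \<open>Ultrafilters\<close>

lemma nonprincipal_ultrafilter_le_sequentially:
  assumes u: "nonprincipal_ultrafilter u"
  shows "u \<le> sequentially"
proof (rule filter_leI)
  have ne: "\<forall>\<^sub>F n in u. n \<noteq> m" for m
  proof (rule ccontr)
    assume "\<not> (\<forall>\<^sub>F n in u. n \<noteq> m)"
    then have m: "\<forall>\<^sub>F n in u. n = m"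
      using u unfolding nonprincipal_ultrafilter_def by (metis (mono_tags, lifting) eventually_mono)
    have "u = principal {m}"
    proof (rule antisym)
      show "u \<le> principal {m}"
        using m by (simp add: le_principal)
      show "principal {m} \<le> u"
      proof (rule filter_leI)
        fix P assume "eventually P u"
        with m have "\<forall>\<^sub>F n in u. P n \<and> n = m"
          by eventually_elim simp
        then have "P m"
          using u eventually_happens' unfolding nonprincipal_ultrafilter_def by blast
        then show "eventually P (principal {m})"
          by (simp add: eventually_principal)
      qed
    qed
    then show False
      using u by (simp add: nonprincipal_ultrafilter_def)
  qed
  fix P :: "nat \<Rightarrow> bool"
  assume "eventually P sequentially"
  then obtain N where N: "\<And>n. N \<le> n \<Longrightarrow> P n"
    by (auto simp: eventually_sequentially)
  have "\<forall>\<^sub>F n in u. \<forall>m\<in>{..<N}. n \<noteq> m"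
    by (intro eventually_ball_finite ballI ne) simp
  then show "eventually P u"
    by (rule eventually_mono) (metis N lessThan_iff not_le)
qed

text \<open>
  Compactness of the interval gives a cluster point, and along an ultrafilter a cluster point is a limit.
\<close>

lemma ultrafilter_bounded_tendsto:
  fixes f :: "nat \<Rightarrow> real"
  assumes u: "nonprincipal_ultrafilter u" and f: "\<And>n. f n \<in> {a..b}"
  shows "\<exists>l. (f \<longlongrightarrow> l) u"
proof -
  have "filtermap f u \<noteq> bot"
    using u by (simp add: nonprincipal_ultrafilter_def filtermap_bot_iff)
  moreover have "\<forall>\<^sub>F x in filtermap f u. x \<in> {a..b}"
    using f by (simp add: eventually_filtermap)
  ultimately obtain l where l: "inf (nhds l) (filtermap f u) \<noteq> bot"
    using compact_Icc[of a b] unfolding compact_filter by meson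
  have "(f \<longlongrightarrow> l) u"
  proof (rule topological_tendstoI, rule ccontr)
    fix S assume S: "open S" "l \<in> S" and "\<not> (\<forall>\<^sub>F n in u. f n \<in> S)"
    then have "\<forall>\<^sub>F n in u. f n \<notin> S"
      using u unfolding nonprincipal_ultrafilter_def by metis
    then have "\<forall>\<^sub>F x in filtermap f u. x \<notin> S"
      by (simp add: eventually_filtermap)
    moreover have "\<forall>\<^sub>F x in nhds l. x \<in> S"
      using S by (auto simp: eventually_nhds)
    ultimately have "\<forall>\<^sub>F x in inf (nhds l) (filtermap f u). False"
      unfolding eventually_inf by blast
    then show False
      using l by (simp add: trivial_limit_def)
  qed
  then show ?thesis ..
qed

lemma cball_subset_ball:
  fixes w :: "'a::nonarch_valued_field"
  assumes "absval w < 1" "r < 1"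
  shows "cball w r \<subseteq> ball 0 1"
proof
  fix x assume "x \<in> cball w r"
  then have "absval ((x - w) + w) < 1"
    using assms by (intro absval_add_less) (auto simp: mem_cball_iff_absval simp del: mem_cball)
  then show "x \<in> ball 0 1"
    by (simp add: dist_absval)
qed

text \<open>
  On bounded series the limit that defines \<open>zeta_ultra\<close> exists, hence \<open>Lim\<close> returns it and not an
  arbitrary number.
\<close>

lemma seminorm_ker_zeta_ultra:
  fixes z :: "nat \<Rightarrow> 'a::{nonarch_valued_field, complete_space}"
  assumes u: "nonprincipal_ultrafilter u"
    and D: "\<And>n. cball (z n) (root (k n) r) \<noteq> {}" "\<And>n. cball (z n) (root (k n) r) \<subseteq> ball 0 1"
  shows "seminorm_ker (zeta_ultra z u k r) = null_ideal (\<lambda>n. cball (z n) (root (k n) r)) u"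
proof -
  have "zeta_ultra z u k r f = 0 \<longleftrightarrow> ((\<lambda>n. zeta_disk (cball (z n) (root (k n) r)) f) \<longlongrightarrow> 0) u"
    if f: "f \<in> carrier Hinf" for f
  proof -
    obtain A where A: "coeffs_le f A"
      using f carrier_Hinf_iff by blast
    have bounds: "zeta_disk (cball (z n) (root (k n) r)) f \<in> {0..A}" for n
      using zeta_disk_nonneg[OF D A] D(2)[of n]
      by (auto intro!: zeta_disk_leI[OF D(1)] absval_ps_eval_le[OF A]
          simp: subset_iff mem_ball_0_iff_absval simp del: mem_ball mem_cball)
    obtain l where l: "((\<lambda>n. zeta_disk (cball (z n) (root (k n) r)) f) \<longlongrightarrow> l) u"
      using ultrafilter_bounded_tendsto[OF u, of "\<lambda>n. zeta_disk (cball (z n) (root (k n) r)) f",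
          OF bounds]
      by (elim exE)
    have "u \<noteq> bot"
      using u by (simp add: nonprincipal_ultrafilter_def)
    then have "zeta_ultra z u k r f = l"
      unfolding zeta_ultra_def using l by (intro tendsto_Lim)
    then show ?thesis
      using l tendsto_unique[OF \<open>u \<noteq> bot\<close> l, of 0] by auto
  qed
  then show ?thesis
    by (auto simp: seminorm_ker_def null_ideal_def)
qed

section \<open>Products and series of real numbers\<close>

lemma prod_subset_ge:
  fixes p :: "'b \<Rightarrow> real"
  assumes "finite T" "S \<subseteq> T" "\<And>x. x \<in> T \<Longrightarrow> 0 \<le> p x" "\<And>x. x \<in> T \<Longrightarrow> p x \<le> 1"
  shows "prod p T \<le> prod p S"
proof -
  have "prod p T = prod p (T - S) * prod p S"
    using assms by (intro prod.subset_diff)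
  also have "\<dots> \<le> 1 * prod p S"
    using assms by (intro mult_right_mono prod_le_1 prod_nonneg) auto
  finally show ?thesis by simp
qed

lemma finite_if_prod_ge:
  fixes p :: "'b \<Rightarrow> real"
  assumes "0 < \<delta>" "s < 1" "\<And>m. m \<in> T \<Longrightarrow> 0 \<le> p m" "\<And>m. m \<in> T \<Longrightarrow> p m \<le> s"
    and ge: "\<And>S. finite S \<Longrightarrow> S \<subseteq> T \<Longrightarrow> \<delta> \<le> prod p S"
  shows "finite T"
proof (rule ccontr)
  assume inf: "infinite T"
  then obtain t where "t \<in> T"
    using infinite_imp_nonempty by blast
  then have "0 \<le> s"
    using assms(3,4) order_trans by blast
  obtain n where n: "s ^ n < \<delta>"
    using real_arch_pow_inv[OF \<open>0 < \<delta>\<close> \<open>s < 1\<close>] by blast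
  obtain S where S: "finite S" "card S = n" "S \<subseteq> T"
    using infinite_arbitrarily_large[OF inf] by blast
  have "prod p S \<le> (\<Prod>m\<in>S. s)"
    using S assms by (intro prod_mono) auto
  then show False
    using ge[OF S(1,3)] S n by simp
qed

text \<open>
  If \<open>t n\<close> is the tail from \<open>n\<close> on, then \<open>x n = t n - t (Suc n)\<close>, and \<open>x n / sqrt (t n)\<close> is at most
  \<open>2 * (sqrt (t n) - sqrt (t (Suc n)))\<close>, which telescopes. So weights near \<open>1 / sqrt (t n)\<close> are possible.
\<close>

lemma exists_weights_preserving_summability:
  fixes x :: "nat \<Rightarrow> real"
  assumes x: "\<And>n. 0 \<le> x n" "summable x"
  shows "\<exists>c :: nat \<Rightarrow> nat. filterlim c at_top sequentially \<and> (\<forall>n. 1 \<le> c n)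
            \<and> summable (\<lambda>n. real (c n) * x n)"
proof -
  \<comment> \<open>The geometric term keeps the tails positive even if \<open>x\<close> vanishes from some index on.\<close>
  define y where "y n = x n + (1 / 2) ^ n" for n
  have y: "0 < y n" "x n \<le> y n" for n
    using x(1)[of n] by (auto simp: y_def add_nonneg_pos)
  have sum_y: "summable y"
    unfolding y_def by (intro summable_add x summable_geometric) auto
  define t where "t n = (\<Sum>i. y (i + n))" for n
  have t_pos: "0 < t n" for n
    unfolding t_def using sum_y y by (intro suminf_pos) auto
  have t_diff: "y n = t n - t (Suc n)" for n
    using suminf_split_head[of "\<lambda>i. y (i + n)"] sum_y by (simp add: t_def)
  have t_lim: "t \<longlonglongrightarrow> 0"
  proof (rule LIMSEQ_I)
    fix e :: real assume "0 < e"
    then show "\<exists>N. \<forall>n\<ge>N. norm (t n - 0) < e"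
      using suminf_exist_split[OF _ sum_y] by (simp add: t_def)
  qed
  then have sqrt_lim: "(\<lambda>n. sqrt (t n)) \<longlonglongrightarrow> 0"
    using tendsto_real_sqrt by fastforce
  define c where "c n = Suc (nat \<lfloor>1 / sqrt (t n)\<rfloor>)" for n
  have "filterlim c at_top sequentially"
    unfolding filterlim_at_top
  proof
    fix Z :: nat
    have "\<forall>\<^sub>F n in sequentially. sqrt (t n) < 1 / real (Suc Z)"
      by (intro order_tendstoD[OF sqrt_lim]) simp
    then show "\<forall>\<^sub>F n in sequentially. Z \<le> c n"
    proof eventually_elim
      case (elim n)
      have "real Z * sqrt (t n) \<le> real (Suc Z) * sqrt (t n)"
        using less_imp_le[OF t_pos[of n]] by (intro mult_right_mono) auto
      also have "\<dots> \<le> 1"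
        using elim by (simp add: field_simps)
      finally have "real Z \<le> 1 / sqrt (t n)"
        using t_pos[of n] by (simp add: le_divide_eq)
      then show ?case
        by (simp add: c_def le_nat_floor le_SucI)
    qed
  qed
  moreover have "summable (\<lambda>n. real (c n) * x n)"
  proof (rule summable_comparison_test')
    show "summable (\<lambda>n. y n + 2 * (sqrt (t n) - sqrt (t (Suc n))))"
      by (intro summable_add summable_mult sum_y telescope_summable'[OF sqrt_lim])
    show "norm (real (c n) * x n) \<le> y n + 2 * (sqrt (t n) - sqrt (t (Suc n)))" for n
    proof -
      let ?a = "sqrt (t n)" and ?b = "sqrt (t (Suc n))"
      have a: "0 < ?a" "0 < ?b" "?b \<le> ?a"
        using t_pos t_diff[of n] y(1)[of n] by auto
      have "y n = (?a - ?b) * (?a + ?b)"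
        using t_pos[of n] t_pos[of "Suc n"] by (simp add: t_diff algebra_simps)
      also have "\<dots> \<le> (?a - ?b) * (2 * ?a)"
        using a by (intro mult_left_mono) auto
      finally have "1 / ?a * y n \<le> 2 * (?a - ?b)"
        using a by (simp add: field_simps)
      moreover have "real (c n) \<le> 1 + 1 / ?a"
        using a by (simp add: c_def of_nat_nat)
      then have "real (c n) * x n \<le> (1 + 1 / ?a) * y n"
        using x y[of n] a by (intro mult_mono) auto
      ultimately show ?thesis
        using x(1)[of n] by (simp add: algebra_simps)
    qed
  qed
  ultimately show ?thesis
    by (intro exI[of _ c]) (auto simp: c_def)
qed

section \<open>Compatible multiplicities\<close>

lemma
  fixes z :: "nat \<Rightarrow> 'a::nonarch_valued_field"
  assumes z: "\<And>n. absval (z n) < 1"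
  shows comp_product_nonneg: "0 \<le> comp_product z k C n"
    and comp_product_le_prod:
      "finite S \<Longrightarrow> S \<subseteq> C - {n} \<Longrightarrow> comp_product z k C n \<le> (\<Prod>m\<in>S. absval (z n - z m) ^ k m)"
proof -
  let ?p = "\<lambda>m. absval (z n - z m) ^ k m" and ?I = "\<lambda>N. {m \<in> C. m \<noteq> n \<and> m < N}"
  let ?P = "\<lambda>N. prod ?p (?I N)"
  have p: "0 \<le> ?p m" "?p m \<le> 1" for m
    using less_imp_le[OF absval_diff_less[OF z[of n] z[of m]]] by (auto intro: power_le_one)
  have fin: "finite (?I N)" for N
    by (rule finite_subset[of _ "{..<N}"]) auto
  have dec: "decseq ?P"
    unfolding decseq_def by (intro allI impI prod_subset_ge[OF fin] p) auto
  have nonneg: "0 \<le> ?P N" for N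
    by (intro prod_nonneg) (simp add: p)
  obtain L where "?P \<longlonglongrightarrow> L"
    by (rule decseq_convergent[OF dec, of 0]) (use nonneg in auto)
  then have lim: "?P \<longlonglongrightarrow> comp_product z k C n"
    by (simp add: comp_product_def limI)
  show "0 \<le> comp_product z k C n"
    using lim nonneg by (intro LIMSEQ_le_const) auto
  assume S: "finite S" "S \<subseteq> C - {n}"
  obtain N where N: "\<And>m. m \<in> S \<Longrightarrow> m < N"
    using S(1) finite_nat_set_iff_bounded by auto
  have "comp_product z k C n \<le> ?P N"
    by (rule decseq_ge[OF dec lim])
  also have "\<dots> \<le> prod ?p S"
    using S N by (intro prod_subset_ge[OF fin] p) auto
  finally show "comp_product z k C n \<le> prod ?p S" .
qed

text \<open>
  The limit of the decreasing partial products is below each finite product, which is the form in which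
  compatibility enters the estimates.
\<close>

lemma Comp_finite_products:
  fixes z :: "nat \<Rightarrow> 'a::nonarch_valued_field"
  assumes z: "\<And>n. absval (z n) < 1" and k: "k \<in> Comp u z"
  obtains C \<delta> where "\<forall>\<^sub>F n in u. n \<in> C" "0 < \<delta>"
    "\<And>n S. n \<in> C \<Longrightarrow> finite S \<Longrightarrow> S \<subseteq> C - {n} \<Longrightarrow> \<delta> \<le> (\<Prod>m\<in>S. absval (z n - z m) ^ k m)"
proof -
  obtain C where C: "\<forall>\<^sub>F n in u. n \<in> C" and pos: "0 < (INF n\<in>C. comp_product z k C n)"
    using k by (auto simp: Comp_def)
  have "(INF n\<in>C. comp_product z k C n) \<le> comp_product z k C n" if "n \<in> C" for n
    by (intro cINF_lower that bdd_belowI2[of _ 0] comp_product_nonneg z)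
  then show thesis
    by (intro that[OF C pos] order_trans[OF _ comp_product_le_prod[OF z]]) auto
qed

text \<open>
  Fix \<open>n0\<close> in \<open>C\<close>. The points with \<open>|z m| > |z n0|\<close> satisfy \<open>|z n0 - z m| = |z m|\<close>, so for them the bound
  on the products of distances to \<open>z n0\<close> is a bound on the products of the \<open>|z m|^k m\<close>. Only finitely many
  points are not of this kind, as each of them contributes a factor of at most \<open>|z n0| < 1\<close>.
\<close>

lemma eventually_absval_products_ge:
  fixes z :: "nat \<Rightarrow> 'a::nonarch_valued_field"
  assumes z: "\<And>n. absval (z n) < 1" and k: "\<And>n. 1 \<le> k n" and "0 < \<delta>" and "C \<noteq> {}"
    and ge: "\<And>n S. n \<in> C \<Longrightarrow> finite S \<Longrightarrow> S \<subseteq> C - {n} \<Longrightarrow> \<delta> \<le> (\<Prod>m\<in>S. absval (z n - z m) ^ k m)"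
  obtains E where "finite E" "\<And>m. m \<in> C - E \<Longrightarrow> z m \<noteq> 0"
    "\<And>S. finite S \<Longrightarrow> S \<subseteq> C - E \<Longrightarrow> \<delta> \<le> (\<Prod>m\<in>S. absval (z m) ^ k m)"
proof -
  obtain n0 where n0: "n0 \<in> C"
    using \<open>C \<noteq> {}\<close> by blast
  let ?T = "{m \<in> C - {n0}. absval (z m) \<le> absval (z n0)}"
  have "finite ?T"
  proof (rule finite_if_prod_ge[OF \<open>0 < \<delta>\<close> z[of n0]])
    fix m assume m: "m \<in> ?T"
    have "absval (z n0 - z m) ^ k m \<le> absval (z n0 - z m) ^ 1"
      using k[of m] absval_diff_less[OF z z] by (intro power_decreasing) (auto intro: less_imp_le)
    also have "\<dots> \<le> absval (z n0)"
      using m by (auto intro: absval_diff_le)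
    finally show "absval (z n0 - z m) ^ k m \<le> absval (z n0)" .
  qed (use ge[OF n0] in auto)
  have larger: "absval (z n0) < absval (z m)" if "m \<in> C - insert n0 ?T" for m
    using that by auto
  have far: "absval (z n0 - z m) = absval (z m)" if "m \<in> C - insert n0 ?T" for m
    using absval_add_eq_right[of "z n0" "- z m"] larger[OF that] by simp
  show ?thesis
  proof (rule that[of "insert n0 ?T"])
    show "finite (insert n0 ?T)"
      using \<open>finite ?T\<close> by simp
    show "z m \<noteq> 0" if "m \<in> C - insert n0 ?T" for m
      using le_less_trans[OF absval_nonneg larger[OF that]] by simp
    show "\<delta> \<le> (\<Prod>m\<in>S. absval (z m) ^ k m)" if S: "finite S" "S \<subseteq> C - insert n0 ?T" for S
    proof -
      have "(\<Prod>m\<in>S. absval (z n0 - z m) ^ k m) = (\<Prod>m\<in>S. absval (z m) ^ k m)"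
        using S far by (intro prod.cong) (auto simp: subset_iff)
      then show ?thesis
        using ge[OF n0 S(1)] S(2) by auto
    qed
  qed
qed

section \<open>Infinite products of power series\<close>

text \<open>
  A factor that is 1 up to order \<open>q\<close> does not change the coefficients below \<open>q\<close> of a partial product. So
  each coefficient is eventually constant, and the limit inherits the common bound. At a point of the unit
  disk the high order coefficients, on which limit and partial product may differ, contribute little.
\<close>

lemma exists_infinite_product:
  fixes F :: "nat \<Rightarrow> 'a::{nonarch_valued_field, complete_space} fps"
  assumes F: "\<And>m. coeffs_le (F m) (a m)"
    and ord: "\<And>m. fps_X ^ q m dvd F m - 1"
    and q: "\<And>m. 1 \<le> q m" "filterlim q at_top sequentially"
    and A: "\<And>N. (\<Prod>m<N. a m) \<le> A"
  obtains B where "coeffs_le B A" "B \<noteq> 0"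
    "\<And>w. absval w < 1 \<Longrightarrow> (\<lambda>N. \<Prod>m<N. ps_eval (F m) w) \<longlonglongrightarrow> ps_eval B w"
proof -
  define P where "P N = (\<Prod>m<N. F m)" for N
  have P: "coeffs_le (P N) A" for N
    unfolding P_def by (rule coeffs_le_mono[OF coeffs_le_prod[OF F] A])
  have step: "fps_nth (P (Suc N)) j = fps_nth (P N) j" if "j < q N" for N j
  proof -
    obtain G where G: "F N - 1 = fps_X ^ q N * G"
      using ord[of N] by (elim dvdE)
    have "P (Suc N) - P N = P N * (F N - 1)"
      by (simp add: P_def algebra_simps)
    also have "\<dots> = fps_X ^ q N * (P N * G)"
      by (simp add: G mult_ac)
    finally have "fps_nth (P (Suc N) - P N) j = 0"
      using that by (simp only: fps_X_power_mult_nth) simp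
    then show ?thesis by simp
  qed
  have "\<exists>b. \<forall>\<^sub>F N in sequentially. fps_nth (P N) j = b" for j
  proof -
    obtain M where M: "\<And>N. M \<le> N \<Longrightarrow> j < q N"
      using q(2) unfolding filterlim_at_top eventually_sequentially by (metis Suc_le_eq)
    have "fps_nth (P N) j = fps_nth (P M) j" if "M \<le> N" for N
      using that by (induction rule: dec_induct) (simp_all add: step M)
    then show ?thesis
      unfolding eventually_sequentially by blast
  qed
  then obtain b where b: "\<And>j. \<forall>\<^sub>F N in sequentially. fps_nth (P N) j = b j"
    by metis
  define B where "B = Abs_fps b"
  have B: "coeffs_le B A"
    unfolding coeffs_le_def
  proof
    fix j
    obtain N where "fps_nth (P N) j = b j"
      using eventually_happens'[OF _ b] by auto
    then show "absval (fps_nth B j) \<le> A"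
      using coeffs_leD[OF P, of N j] by (simp add: B_def)
  qed
  have P0: "fps_nth (P N) 0 = 1" for N
  proof (induction N)
    case (Suc N)
    then show ?case
      using step[of 0 N] q(1)[of N] by simp
  qed (simp add: P_def)
  have "b 0 = 1"
    using eventually_happens'[OF _ b[of 0]] P0 by simp
  then have "B \<noteq> 0"
    by (auto simp: B_def fps_eq_iff intro!: exI[of _ 0])
  moreover have "(\<lambda>N. \<Prod>m<N. ps_eval (F m) w) \<longlonglongrightarrow> ps_eval B w" if w: "absval w < 1" for w
  proof -
    have "(\<lambda>N. ps_eval (P N) w) \<longlonglongrightarrow> ps_eval B w"
      unfolding tendsto_absval_iff[of _ "ps_eval B w"]
    proof (rule LIMSEQ_I)
      fix e :: real assume "0 < e"
      have "(\<lambda>J. A * absval w ^ J) \<longlonglongrightarrow> 0"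
        using w by (intro tendsto_mult_right_zero LIMSEQ_realpow_zero) auto
      then obtain J where J: "A * absval w ^ J < e"
        using order_tendstoD(2)[OF _ \<open>0 < e\<close>] eventually_happens' sequentially_bot by blast
      have "\<forall>\<^sub>F N in sequentially. \<forall>j\<in>{..<J}. fps_nth (P N) j = b j"
        by (intro eventually_ball_finite ballI b) simp
      then obtain N0 where N0: "\<And>N j. N0 \<le> N \<Longrightarrow> j < J \<Longrightarrow> fps_nth (P N) j = b j"
        by (auto simp: eventually_sequentially)
      have "absval (ps_eval (P N) w - ps_eval B w) < e" if "N0 \<le> N" for N
      proof (rule le_less_trans[OF ps_eval_cong_order[OF P B w] J])
        show "fps_nth (P N) j = fps_nth B j" if "j < J" for j
          using N0[OF \<open>N0 \<le> N\<close> that] by (simp add: B_def)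
      qed
      then show "\<exists>N0. \<forall>N\<ge>N0. norm (absval (ps_eval (P N) w - ps_eval B w) - 0) < e"
        by auto
    qed
    then show ?thesis
      unfolding P_def ps_eval_prod[OF F w] .
  qed
  ultimately show thesis
    using that[OF B] by blast
qed

section \<open>Factors with a prescribed zero that are 1 to high order\<close>

text \<open>
  A substitute for the linear factor \<open>1 - X / a\<close> that is 1 up to order \<open>q\<close>. Since
  \<open>1 - W^q * (1 + c * (W - 1)) = (1 - W) * ((\<Sum>i<q. W ^ i) + c * W ^ q)\<close>, it has the same zero \<open>a\<close>, and \<open>c\<close> is
  a parameter that moves the other zeros.
\<close>

definition vanishing_factor :: "'a::nonarch_valued_field \<Rightarrow> nat \<Rightarrow> 'a \<Rightarrow> 'a fps" where
  "vanishing_factor a q c =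
     (let W = fps_const (1 / a) * fps_X in 1 - W ^ q * (1 + fps_const c * (W - 1)))"

lemma X_power_dvd_factor: "fps_X ^ q dvd vanishing_factor a q c - 1"
  by (simp add: vanishing_factor_def Let_def power_mult_distrib)

lemma X_power_dvd_factor_power: "fps_X ^ q dvd vanishing_factor a q c ^ l - 1"
  using X_power_dvd_factor[of q a c] power_diff_1_eq[of "vanishing_factor a q c" l]
  by (metis dvd_mult2)

lemma coeffs_le_factor:
  assumes a: "a \<noteq> 0" "absval a \<le> 1" and c: "absval c \<le> 1"
  shows "coeffs_le (vanishing_factor a q c) (1 / absval a ^ (q + 1))"
proof -
  define R where "R = 1 / absval a"
  have R: "1 \<le> R"
    using a by (simp add: R_def)
  define W where "W = fps_const (1 / a) * fps_X"
  have one: "coeffs_le 1 (R ^ n)" for n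
    using R by (intro coeffs_le_mono[OF coeffs_le_1]) auto
  have W: "coeffs_le W R"
    using coeffs_le_mult[OF coeffs_le_const coeffs_le_X, of "1 / a"]
    by (simp add: W_def R_def absval_divide)
  have "coeffs_le (fps_const c * (W - 1)) (absval c * R)"
    using W one[of 1] by (intro coeffs_le_mult coeffs_le_const coeffs_le_diff) auto
  then have "coeffs_le (fps_const c * (W - 1)) R"
    by (rule coeffs_le_mono) (use c R in \<open>simp add: mult_left_le_one_le\<close>)
  then have "coeffs_le (1 + fps_const c * (W - 1)) R"
    using one[of 1] by (intro coeffs_le_add) auto
  then have "coeffs_le (W ^ q * (1 + fps_const c * (W - 1))) (R ^ (q + 1))"
    unfolding power_add power_one_right by (intro coeffs_le_mult coeffs_le_power W)
  then have "coeffs_le (vanishing_factor a q c) (R ^ (q + 1))"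
    unfolding vanishing_factor_def Let_def W_def[symmetric] by (intro coeffs_le_diff one)
  then show ?thesis
    by (simp add: R_def power_one_over)
qed

lemma ps_eval_factor:
  fixes a :: "'a::{nonarch_valued_field, complete_space}"
  assumes w: "absval w < 1"
  shows "ps_eval (vanishing_factor a q c) w = (1 - w / a) * ((\<Sum>i<q. (w / a) ^ i) + c * (w / a) ^ q)"
proof -
  define W where "W = fps_const (1 / a) * fps_X"
  note bounds = coeffs_le_const coeffs_le_X coeffs_le_1
  have W: "coeffs_le W (absval (1 / a) * 1)"
    unfolding W_def by (intro coeffs_le_mult bounds)
  define R where "R = max 1 (absval (1 / a) * 1)"
  have W': "coeffs_le W R" and one: "coeffs_le 1 R"
    using W bounds(3) by (auto simp: R_def elim: coeffs_le_mono)
  have evW: "ps_eval W w = w / a"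
    unfolding W_def ps_eval_mult[OF bounds(1,2) w] by (simp add: ps_eval_const ps_eval_X w)
  have 1: "coeffs_le (fps_const c * (W - 1)) (absval c * R)"
    by (intro coeffs_le_mult coeffs_le_diff bounds W' one)
  have ev1: "ps_eval (fps_const c * (W - 1)) w = c * (w / a - 1)"
    unfolding ps_eval_mult[OF bounds(1) coeffs_le_diff[OF W' one] w] ps_eval_diff[OF W one w]
    by (simp add: ps_eval_const w evW)
  have 2: "coeffs_le (1 + fps_const c * (W - 1)) (max 1 (absval c * R))"
    using 1 bounds(3) by (intro coeffs_le_add) (auto elim: coeffs_le_mono)
  have ev2: "ps_eval (1 + fps_const c * (W - 1)) w = 1 + c * (w / a - 1)"
    unfolding ps_eval_add[OF bounds(3) 1 w] by (simp add: ev1 w)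
  have "ps_eval (vanishing_factor a q c) w = 1 - (w / a) ^ q * (1 + c * (w / a - 1))"
    unfolding vanishing_factor_def Let_def W_def[symmetric]
      ps_eval_diff[OF bounds(3) coeffs_le_mult[OF coeffs_le_power[OF W] 2] w]
      ps_eval_mult[OF coeffs_le_power[OF W] 2 w] ps_eval_power[OF W w]
    by (simp add: ev2 evW w)
  also have "\<dots> = (1 - (w / a) ^ q) + (1 - w / a) * (c * (w / a) ^ q)"
    by (simp add: algebra_simps)
  also have "1 - (w / a) ^ q = (1 - w / a) * (\<Sum>i<q. (w / a) ^ i)"
    by (rule one_diff_power_eq)
  finally show ?thesis
    by (simp add: algebra_simps)
qed

lemma absval_one_minus_divide:
  "a \<noteq> 0 \<Longrightarrow> absval (1 - w / a) = absval (a - w) / absval a"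
  by (simp add: diff_divide_distrib flip: absval_divide)

lemma absval_ps_eval_factor_le:
  fixes a :: "'a::{nonarch_valued_field, complete_space}"
  assumes a: "a \<noteq> 0" "absval a \<le> 1" and c: "absval c \<le> 1" and w: "absval w < 1"
  shows "absval (ps_eval (vanishing_factor a q c) w) \<le> absval (a - w) * (1 / absval a ^ (q + 1))"
proof -
  define R where "R = 1 / absval a"
  have R: "1 \<le> R"
    using a by (simp add: R_def)
  have wa: "absval (w / a) \<le> R"
    using a w by (simp add: R_def absval_divide divide_right_mono)
  have pow: "absval ((w / a) ^ i) \<le> R ^ q" if "i \<le> q" for i
  proof -
    have "absval (w / a) ^ i \<le> R ^ i"
      using wa by (intro power_mono) auto
    also have "\<dots> \<le> R ^ q"
      using R that by (intro power_increasing)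
    finally show ?thesis by (simp add: absval_power)
  qed
  have "absval c * absval ((w / a) ^ q) \<le> 1 * R ^ q"
    using c pow[of q] by (intro mult_mono) auto
  then have "absval ((\<Sum>i<q. (w / a) ^ i) + c * (w / a) ^ q) \<le> R ^ q"
    using R pow by (intro absval_add_le absval_sum_le) (auto simp: absval_mult)
  then have "absval (1 - w / a) * absval ((\<Sum>i<q. (w / a) ^ i) + c * (w / a) ^ q)
      \<le> (absval (a - w) * R) * R ^ q"
    using a R by (intro mult_mono) (auto simp: absval_one_minus_divide R_def)
  then show ?thesis
    by (simp add: ps_eval_factor[OF w] absval_mult R_def power_one_over mult_ac)
qed

text \<open>
  The claim is that the cofactor \<open>G = (\<Sum>i<q. s ^ i) + c * s ^ q\<close> has absolute value at least 1 at
  \<open>s = w / a\<close>. If \<open>|s| < 1\<close> then the term 1 dominates \<open>G\<close>, and if \<open>|s| > 1\<close> then the last term does. For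
  \<open>|s| = 1\<close> it says that \<open>c\<close> avoids the residue class of \<open>- (\<Sum>i<q. s ^ i) / s ^ q\<close>, and as \<open>w\<close> is then
  restricted to a finite set, there are only finitely many classes to avoid.
\<close>

lemma exists_separating_coefficient:
  fixes a :: "'a::complete_alg_closed_nonarch_field"
  assumes a: "a \<noteq> 0" "absval a \<le> 1" and q: "1 \<le> q" and Y: "finite Y"
  shows "\<exists>c. absval c = 1 \<and> (\<forall>w. absval w < 1 \<and> (absval w = absval a \<longrightarrow> w \<in> Y) \<longrightarrow>
            absval (a - w) \<le> absval (ps_eval (vanishing_factor a q c) w))"
proof -
  obtain c where c: "absval c = 1"
    and sep: "\<And>y. y \<in> Y \<Longrightarrow> 1 \<le> absval (c - (- (\<Sum>i<q. (y / a) ^ i) / (y / a) ^ q))"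
    using exists_avoiding_residue_classes[of "(\<lambda>y. - (\<Sum>i<q. (y / a) ^ i) / (y / a) ^ q) ` Y"] Y
    by auto
  have "absval (a - w) \<le> absval (ps_eval (vanishing_factor a q c) w)"
    if w: "absval w < 1" "absval w = absval a \<longrightarrow> w \<in> Y" for w
  proof -
    define s where "s = w / a"
    let ?T = "\<Sum>i<q. s ^ i"
    have "1 \<le> absval (?T + c * s ^ q)"
    proof (cases "absval s" "1 :: real" rule: linorder_cases)
      case less
      obtain q' where q': "q = Suc q'"
        using q by (cases q) auto
      have pow: "absval (s ^ Suc i) < 1" for i
        unfolding absval_power using power_decreasing[of 1 "Suc i" "absval s"] less by simp
      have "absval ((\<Sum>i<q'. s ^ Suc i) + c * s ^ q) < 1"
        using pow c q' by (intro absval_add_less absval_sum_less) (simp_all add: absval_mult del: power_Suc)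
      then have "absval (((\<Sum>i<q'. s ^ Suc i) + c * s ^ q) + 1) = 1"
        using absval_add_eq_right[of _ 1] by simp
      then show ?thesis
        unfolding q' sum.lessThan_Suc_shift by (simp add: algebra_simps)
    next
      case equal
      then have "w \<in> Y"
        using w a by (auto simp: s_def absval_divide)
      have "s \<noteq> 0"
        using equal by auto
      then have "?T + c * s ^ q = (c - (- ?T / s ^ q)) * s ^ q"
        by (simp add: field_simps)
      then show ?thesis
        using sep[OF \<open>w \<in> Y\<close>] equal by (simp add: s_def absval_mult absval_power)
    next
      case greater
      have "absval ?T < absval (c * s ^ q)"
        using greater c
        by (intro absval_sum_less)
           (auto simp: absval_mult absval_power intro: power_strict_increasing zero_less_power
             order_less_trans[OF zero_less_one])
      then have "absval (?T + c * s ^ q) = absval s ^ q"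
        using absval_add_eq_right[of ?T "c * s ^ q"] c by (simp add: absval_mult absval_power)
      then show ?thesis
        using greater by (simp add: one_le_power)
    qed
    moreover have "absval (a - w) \<le> absval (1 - w / a)"
      using a by (simp add: absval_one_minus_divide le_divide_eq mult_left_le)
    ultimately have "absval (a - w) * 1 \<le> absval (1 - w / a) * absval (?T + c * s ^ q)"
      by (intro mult_mono) auto
    then show ?thesis
      by (simp add: ps_eval_factor[OF w(1)] s_def absval_mult)
  qed
  with c show ?thesis by blast
qed

section \<open>Products with prescribed zeros\<close>

text \<open>
  The product of the \<open>vanishing_factor (z m) (q m) (c m) ^ l m\<close> over \<open>m\<close> in \<open>C\<close>. The last conclusion holds
  since \<open>w\<close> close to \<open>z n\<close> makes the factor with index \<open>n\<close> small, whereas all other factors are at most their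
  coefficient bounds. The limit in the third conclusion is the access to lower bounds.
\<close>

lemma exists_product_with_zeros:
  fixes z :: "nat \<Rightarrow> 'a::{nonarch_valued_field, complete_space}"
  assumes z: "\<And>m. absval (z m) < 1" and nonzero: "\<And>m. m \<in> C \<Longrightarrow> z m \<noteq> 0"
    and c: "\<And>m. absval (c m) \<le> 1"
    and q: "\<And>m. 1 \<le> q m" "filterlim q at_top sequentially"
    and l: "\<And>m. m \<notin> C \<Longrightarrow> l m = 0"
    and summ: "summable (\<lambda>m. real (l m * (q m + 1)) * - ln (absval (z m)))"
  obtains B A where "coeffs_le B A" "B \<noteq> 0"
    "\<And>w. absval w < 1 \<Longrightarrow>
       (\<lambda>N. \<Prod>m<N. absval (ps_eval (vanishing_factor (z m) (q m) (c m)) w) ^ l m)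
         \<longlonglongrightarrow> absval (ps_eval B w)"
    "\<And>w n. absval w < 1 \<Longrightarrow> n \<in> C \<Longrightarrow> absval (ps_eval B w) \<le> A * absval (z n - w) ^ l n"
proof -
  define x where "x m = real (l m * (q m + 1)) * - ln (absval (z m))" for m
  define a where "a m = exp (x m)" for m
  define A where "A = exp (suminf x)"
  have a_eq: "a m = (1 / absval (z m) ^ (q m + 1)) ^ l m" if "m \<in> C" for m
  proof -
    have "a m = exp (- ln (absval (z m))) ^ (l m * (q m + 1))"
      unfolding a_def x_def by (rule exp_of_nat_mult)
    also have "exp (- ln (absval (z m))) = 1 / absval (z m)"
      using nonzero[OF that] by (simp add: exp_minus inverse_eq_divide)
    finally show ?thesis
      by (simp only: mult.commute[of "l m"] power_mult power_one_over)
  qed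
  have x: "0 \<le> x m" for m
  proof (cases "m \<in> C")
    case True
    then show ?thesis
      unfolding x_def using z[of m] nonzero by (intro mult_nonneg_nonneg) auto
  qed (simp add: x_def l)
  have A: "(\<Prod>m<N. a m) \<le> A" for N
    using sum_le_suminf[of x "{..<N}"] x summ[folded x_def]
    by (simp add: a_def A_def flip: exp_sum)
  let ?F = "\<lambda>m. vanishing_factor (z m) (q m) (c m)"
  have F: "coeffs_le (?F m) (1 / absval (z m) ^ (q m + 1))" if "m \<in> C" for m
    using nonzero[OF that] z[of m] c by (intro coeffs_le_factor) auto
  have F_power: "coeffs_le (?F m ^ l m) (a m)" for m
  proof (cases "m \<in> C")
    case True
    then show ?thesis
      unfolding a_eq[OF True] by (intro coeffs_le_power F)
  qed (simp add: a_def x_def l coeffs_le_1)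
  obtain B where B: "coeffs_le B A" "B \<noteq> 0" and
    lim: "\<And>w. absval w < 1 \<Longrightarrow> (\<lambda>N. \<Prod>m<N. ps_eval (?F m ^ l m) w) \<longlonglongrightarrow> ps_eval B w"
    by (rule exists_infinite_product[OF F_power X_power_dvd_factor_power q A]) (rule that; assumption)
  have ev: "absval (ps_eval (?F m ^ l m) w) = absval (ps_eval (?F m) w) ^ l m"
    if "absval w < 1" for m w
  proof (cases "m \<in> C")
    case True
    then show ?thesis
      using that by (simp add: ps_eval_power[OF F] absval_power)
  qed (simp add: l that)
  have lim': "(\<lambda>N. \<Prod>m<N. absval (ps_eval (?F m) w) ^ l m) \<longlonglongrightarrow> absval (ps_eval B w)"
    if w: "absval w < 1" for w
    using tendsto_absval[OF lim[OF w]] by (simp add: absval_prod ev[OF w])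
  have "absval (ps_eval B w) \<le> A * absval (z n - w) ^ l n" if w: "absval w < 1" and n: "n \<in> C" for w n
  proof (rule LIMSEQ_le_const2[OF lim'[OF w]], intro exI allI impI)
    fix N assume "Suc n \<le> N"
    let ?p = "\<lambda>m. absval (ps_eval (?F m) w) ^ l m"
    have p: "?p m \<le> absval (z m - w) ^ l m * a m" if "m \<in> C" for m
      unfolding a_eq[OF that] power_mult_distrib[symmetric]
      using nonzero[OF that] z[of m] c w
      by (intro power_mono absval_ps_eval_factor_le) auto
    have p': "?p m \<le> a m" for m
    proof (cases "m \<in> C")
      case True
      have "absval (z m - w) ^ l m \<le> 1"
        using absval_diff_less[OF z w] by (intro power_le_one) (auto intro: less_imp_le)
      then have "absval (z m - w) ^ l m * a m \<le> 1 * a m"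
        by (intro mult_right_mono) (auto simp: a_def)
      then show ?thesis
        using p[OF True] by simp
    qed (simp add: a_def x_def l)
    have split: "(\<Prod>m<N. g m) = g n * (\<Prod>m\<in>{..<N} - {n}. g m)" for g :: "nat \<Rightarrow> real"
      using \<open>Suc n \<le> N\<close> by (intro prod.remove) auto
    have "(\<Prod>m<N. ?p m) \<le> (absval (z n - w) ^ l n * a n) * (\<Prod>m\<in>{..<N} - {n}. a m)"
      unfolding split[of ?p] using p[OF n] p'
      by (intro mult_mono prod_mono) (auto simp: a_def intro!: prod_nonneg)
    also have "\<dots> = absval (z n - w) ^ l n * (\<Prod>m<N. a m)"
      by (simp add: split[of a])
    also have "\<dots> \<le> absval (z n - w) ^ l n * A"
      by (intro mult_left_mono A) simp
    finally show "(\<Prod>m<N. ?p m) \<le> A * absval (z n - w) ^ l n"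
      by (simp add: mult.commute)
  qed
  from that[OF B lim' this] show thesis .
qed

text \<open>
  The data extracted from a compatible \<open>k\<close>: a set \<open>C\<close> of indices whose finite products of distances and of
  absolute values are bounded below by one \<open>\<delta>\<close>.
\<close>

locale separated_points =
  fixes z :: "nat \<Rightarrow> 'a::complete_alg_closed_nonarch_field"
    and k :: "nat \<Rightarrow> nat" and C :: "nat set" and \<delta> :: real
  assumes z: "absval (z n) < 1"
    and k: "1 \<le> k n"
    and delta: "0 < \<delta>"
    and nonzero: "m \<in> C \<Longrightarrow> z m \<noteq> 0"
    and separated:
      "n \<in> C \<Longrightarrow> finite S \<Longrightarrow> S \<subseteq> C - {n} \<Longrightarrow> \<delta> \<le> (\<Prod>m\<in>S. absval (z n - z m) ^ k m)"
    and products: "finite S \<Longrightarrow> S \<subseteq> C \<Longrightarrow> \<delta> \<le> (\<Prod>m\<in>S. absval (z m) ^ k m)"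
begin

definition log_mass :: "nat \<Rightarrow> real" where
  "log_mass m = (if m \<in> C then real (k m) * - ln (absval (z m)) else 0)"

lemma log_mass_nonneg: "0 \<le> log_mass m"
  using z[of m] nonzero[of m] by (auto simp: log_mass_def intro!: mult_nonneg_nonpos)

lemma summable_log_mass: "summable log_mass"
proof (rule summableI_nonneg_bounded[OF log_mass_nonneg])
  fix N
  let ?S = "{m \<in> C. m < N}"
  have fin: "finite ?S"
    by (rule finite_subset[of _ "{..<N}"]) auto
  have "sum log_mass {..<N} = (\<Sum>m\<in>?S. log_mass m)"
    by (intro sum.mono_neutral_right) (auto simp: log_mass_def)
  also have "\<dots> = - (\<Sum>m\<in>?S. ln (absval (z m) ^ k m))"
    using nonzero by (simp add: log_mass_def ln_realpow sum_negf)
  also have "\<dots> = - ln (\<Prod>m\<in>?S. absval (z m) ^ k m)"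
    using nonzero fin by (subst ln_prod) auto
  also have "\<dots> \<le> - ln \<delta>"
    using delta products[OF fin] by (subst neg_le_iff_le, subst ln_le_cancel_iff) (auto intro: less_le_trans)
  finally show "sum log_mass {..<N} \<le> - ln \<delta>" .
qed

text \<open>
  Orders \<open>q m\<close> that tend to infinity, as coefficientwise convergence requires, and yet so slowly that the
  products of the coefficient bounds \<open>1 / |z m| ^ ((q m + 1) * k m)\<close> remain bounded.
\<close>

lemma exists_orders:
  obtains q where "\<And>m. 1 \<le> q m" "filterlim q at_top sequentially"
    "summable (\<lambda>m. real (q m + 1) * log_mass m)"
proof -
  obtain q where q: "filterlim q at_top sequentially" "\<And>m. 1 \<le> q m"
    and "summable (\<lambda>m. real (q m) * log_mass m)"
    using exists_weights_preserving_summability[OF log_mass_nonneg summable_log_mass] by blast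
  then have "summable (\<lambda>m. real (q m + 1) * log_mass m)"
    using summable_add[OF _ summable_log_mass, of "\<lambda>m. real (q m) * log_mass m"]
    by (simp add: algebra_simps)
  from that[OF q(2,1) this] show thesis .
qed

text \<open>
  A second sequence of weights is used as exponents: the zero at \<open>z n\<close> has multiplicity \<open>k n * c n\<close>,
  of higher order than the \<open>k n\<close> that matches the radius of the disk.
\<close>

lemma exists_nonzero_small_on_disks:
  obtains f A c where "coeffs_le f A" "f \<noteq> 0" "filterlim c at_top sequentially"
    "\<And>w n. absval w < 1 \<Longrightarrow> n \<in> C \<Longrightarrow> absval (ps_eval f w) \<le> A * (absval (z n - w) ^ k n) ^ c n"
proof -
  obtain q where q: "\<And>m. 1 \<le> q m" "filterlim q at_top sequentially"
    and sum_q: "summable (\<lambda>m. real (q m + 1) * log_mass m)"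
    using exists_orders by blast
  have "0 \<le> real (q m + 1) * log_mass m" for m
    by (intro mult_nonneg_nonneg log_mass_nonneg) simp
  then obtain c where c: "filterlim c at_top sequentially"
    and sum_c: "summable (\<lambda>m. real (c m) * (real (q m + 1) * log_mass m))"
    using exists_weights_preserving_summability[OF _ sum_q] by blast
  define l where "l m = (if m \<in> C then k m * c m else 0)" for m
  have l: "l m = 0" if "m \<notin> C" for m
    using that by (simp add: l_def)
  have "real (l m * (q m + 1)) * - ln (absval (z m)) = real (c m) * (real (q m + 1) * log_mass m)" for m
    by (simp add: l_def log_mass_def algebra_simps)
  with sum_c have summ: "summable (\<lambda>m. real (l m * (q m + 1)) * - ln (absval (z m)))"
    by presburger
  have c0: "absval 0 \<le> 1"
    by simp
  obtain f A where f: "coeffs_le f A" "f \<noteq> 0"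
    and small: "\<And>w n. absval w < 1 \<Longrightarrow> n \<in> C \<Longrightarrow> absval (ps_eval f w) \<le> A * absval (z n - w) ^ l n"
    by (rule exists_product_with_zeros[of z C _ q l, OF z nonzero c0 q l summ]) (assumption | rule that)+
  show thesis
  proof (rule that[OF f c])
    fix w :: 'a and n assume "absval w < 1" "n \<in> C"
    then show "absval (ps_eval f w) \<le> A * (absval (z n - w) ^ k n) ^ c n"
      using small[of w n] by (simp add: l_def power_mult)
  qed
qed

text \<open>
  With zeros of multiplicity exactly \<open>k n\<close>, the product can be bounded below near \<open>z n\<close>. The choice
  \<open>|y n - z n|^k n = |a| < \<delta>\<close> puts \<open>y n\<close> closer to \<open>z n\<close> than any other \<open>z m\<close> and than 0, so that
  \<open>|y n - z m| = |z n - z m|\<close> and \<open>|y n| = |z n|\<close>. When the separating coefficient of the factor with index \<open>m\<close>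
  is chosen, only those \<open>y n\<close> with \<open>|y n| = |z m|\<close> have to be taken into account, and they are finitely many.
  Then the factors with \<open>m \<noteq> n\<close> contribute at least \<open>\<delta>\<close>, and the one with \<open>m = n\<close> at least \<open>|a|\<close>.
\<close>

lemma exists_vanishing_but_large_nearby:
  assumes a: "a \<noteq> 0" "absval a < \<delta>"
    and y: "\<And>n. absval (y n - z n) ^ k n = absval a"
  obtains g A where "coeffs_le g A" "\<And>n. n \<in> C \<Longrightarrow> ps_eval g (z n) = 0"
    "\<And>n. n \<in> C \<Longrightarrow> absval a * \<delta> \<le> absval (ps_eval g (y n))"
proof -
  obtain q where q: "\<And>m. 1 \<le> q m" "filterlim q at_top sequentially"
    and sum_q: "summable (\<lambda>m. real (q m + 1) * log_mass m)"
    using exists_orders by blast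
  have y_near: "absval (y n - z n) < r" if "\<delta> \<le> r ^ k n" "0 \<le> r" for n r
  proof (rule power_less_imp_less_base)
    show "absval (y n - z n) ^ k n < r ^ k n"
      using that a y[of n] by simp
  qed (use that in simp)
  have y_abs: "absval (y n) = absval (z n)" if "n \<in> C" for n
  proof -
    have "absval (y n - z n) < absval (z n)"
      using products[of "{n}"] that by (intro y_near) auto
    then show ?thesis
      using absval_add_eq_right[of "y n - z n" "z n"] by simp
  qed
  have y_less: "absval (y n) < 1" if "n \<in> C" for n
    using y_abs[OF that] z[of n] by simp
  have y_sep: "absval (z m - y n) = absval (z n - z m)" if "m \<in> C" "n \<in> C" "m \<noteq> n" for m n
  proof -
    have "absval (z n - y n) < absval (z m - z n)"
      unfolding absval_minus_commute[of "z n" "y n"]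
      using separated[of m "{n}"] that by (intro y_near) auto
    then have "absval (z m - y n) = absval (z m - z n)"
      using absval_add_eq_right[of "z n - y n" "z m - z n"] by simp
    then show ?thesis
      by (simp add: absval_minus_commute)
  qed
  have fin: "finite {n \<in> C. absval (z n) = absval (z m)}" for m
  proof (rule finite_if_prod_ge[OF delta z[of m]])
    fix n assume "n \<in> {n \<in> C. absval (z n) = absval (z m)}"
    then show "absval (z n) ^ k n \<le> absval (z m)"
      using power_decreasing[OF k[of n], of "absval (z n)"] z[of n] by simp
  qed (use products in auto)
  have "\<exists>c. absval c = 1 \<and> (m \<in> C \<longrightarrow>
          (\<forall>n\<in>C. absval (z m - y n) \<le> absval (ps_eval (vanishing_factor (z m) (q m) c) (y n))))" for m
  proof (cases "m \<in> C")
    case True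
    obtain c where c: "absval c = 1"
      and *: "\<forall>w. absval w < 1 \<and>
        (absval w = absval (z m) \<longrightarrow> w \<in> y ` {n \<in> C. absval (z n) = absval (z m)}) \<longrightarrow>
        absval (z m - w) \<le> absval (ps_eval (vanishing_factor (z m) (q m) c) w)"
      using exists_separating_coefficient[OF nonzero[OF True] less_imp_le[OF z] q(1) finite_imageI[OF fin]]
      by blast
    show ?thesis
      using c * y_less y_abs by (intro exI[of _ c]) auto
  qed (use absval_1 in blast)
  then obtain c where c: "\<And>m. absval (c m) = 1"
    and large: "\<And>m n. m \<in> C \<Longrightarrow> n \<in> C \<Longrightarrow>
      absval (z m - y n) \<le> absval (ps_eval (vanishing_factor (z m) (q m) (c m)) (y n))"
    by metis
  define l where "l m = (if m \<in> C then k m else 0)" for m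
  have l: "l m = 0" if "m \<notin> C" for m
    using that by (simp add: l_def)
  have "real (l m * (q m + 1)) * - ln (absval (z m)) = real (q m + 1) * log_mass m" for m
    by (simp add: l_def log_mass_def algebra_simps)
  with sum_q have summ: "summable (\<lambda>m. real (l m * (q m + 1)) * - ln (absval (z m)))"
    by presburger
  have c_le: "absval (c m) \<le> 1" for m
    by (simp add: c)
  obtain g A where g: "coeffs_le g A"
    and lim: "\<And>w. absval w < 1 \<Longrightarrow>
       (\<lambda>N. \<Prod>m<N. absval (ps_eval (vanishing_factor (z m) (q m) (c m)) w) ^ l m)
         \<longlonglongrightarrow> absval (ps_eval g w)"
    and small: "\<And>w n. absval w < 1 \<Longrightarrow> n \<in> C \<Longrightarrow> absval (ps_eval g w) \<le> A * absval (z n - w) ^ l n"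
    by (rule exists_product_with_zeros[of z C c q l, OF z nonzero c_le q l summ]) (assumption | rule that)+
  show thesis
  proof (rule that[OF g])
    fix n assume n: "n \<in> C"
    have "absval (ps_eval g (z n)) \<le> 0"
      using small[OF z n, of n] k[of n] n by (simp add: l_def power_0_left)
    then show "ps_eval g (z n) = 0"
      by (metis absval_eq_0_iff absval_nonneg antisym)
    show "absval a * \<delta> \<le> absval (ps_eval g (y n))"
    proof (rule LIMSEQ_le_const[OF lim[OF y_less[OF n]]], intro exI allI impI)
      fix N assume "Suc n \<le> N"
      let ?p = "\<lambda>m. absval (ps_eval (vanishing_factor (z m) (q m) (c m)) (y n)) ^ l m"
      let ?S = "{m \<in> C. m < N \<and> m \<noteq> n}"
      have finS: "finite ?S"
        by (rule finite_subset[of _ "{..<N}"]) auto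
      have "(\<Prod>m<N. ?p m) = (\<Prod>m\<in>insert n ?S. ?p m)"
        using \<open>Suc n \<le> N\<close> n by (intro prod.mono_neutral_right) (auto simp: l_def)
      also have "\<dots> = ?p n * (\<Prod>m\<in>?S. ?p m)"
        using finS by (intro prod.insert) auto
      finally have eq: "(\<Prod>m<N. ?p m) = ?p n * (\<Prod>m\<in>?S. ?p m)" .
      have "absval a = absval (z n - y n) ^ k n"
        using y[of n] by (simp add: absval_minus_commute)
      also have "\<dots> \<le> ?p n"
        using large[OF n n] n by (simp add: l_def power_mono)
      finally have 1: "absval a \<le> ?p n" .
      have "\<delta> \<le> (\<Prod>m\<in>?S. absval (z n - z m) ^ k m)"
        by (rule separated[OF n finS]) auto
      also have "\<dots> \<le> (\<Prod>m\<in>?S. ?p m)"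
      proof (intro prod_mono conjI)
        fix m assume "m \<in> ?S"
        then show "absval (z n - z m) ^ k m \<le> ?p m"
          using large[of m n] n y_sep[of m n] by (simp add: l_def power_mono)
      qed simp
      finally have 2: "\<delta> \<le> (\<Prod>m\<in>?S. ?p m)" .
      show "absval a * \<delta> \<le> (\<Prod>m<N. ?p m)"
        unfolding eq using 1 2 delta by (intro mult_mono) auto
    qed
  qed
qed

end

section \<open>The kernel of a point\<close>

theorem corollary2p7:
  fixes \<phi> :: "'a::complete_alg_closed_nonarch_field fps \<Rightarrow> real"
  assumes "\<phi> \<in> M1"
  shows "ideal (seminorm_ker \<phi>) Hinf \<and>
         seminorm_ker \<phi> \<noteq> {\<zero>\<^bsub>Hinf\<^esub>} \<and>
         \<not> maximalideal (seminorm_ker \<phi>) Hinf"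
proof -
  obtain z :: "nat \<Rightarrow> 'a" and u k r where \<phi>: "\<phi> = zeta_ultra z u k r"
    and z_ball: "range z \<subseteq> ball 0 1" and u: "nonprincipal_ultrafilter u"
    and k: "k \<in> Comp u z" and r: "0 < r" "r < 1"
    using assms unfolding M1_def by blast
  have z: "absval (z n) < 1" for n
    using z_ball mem_ball_0_iff_absval by blast
  have k1: "1 \<le> k n" for n
    using k by (simp add: Comp_def)
  have u_bot: "u \<noteq> bot"
    using u by (simp add: nonprincipal_ultrafilter_def)
  have u_seq: "u \<le> sequentially"
    by (rule nonprincipal_ultrafilter_le_sequentially[OF u])
  define D where "D n = cball (z n) (root (k n) r)" for n
  have rho: "0 < root (k n) r" "root (k n) r < 1" "root (k n) r ^ k n = r" for n
    using r k1[of n] real_root_lt_1_iff[of "k n" r] by auto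
  have z_D: "z n \<in> D n" for n
    using less_imp_le[OF rho(1)] by (simp add: D_def)
  have D: "D n \<noteq> {}" "D n \<subseteq> ball 0 1" for n
    using z_D unfolding D_def by (blast, intro cball_subset_ball z rho)
  have ker: "seminorm_ker \<phi> = null_ideal D u"
    unfolding \<phi> D_def[abs_def] by (rule seminorm_ker_zeta_ultra[OF u D[unfolded D_def]])
  have Z: "{z n} \<noteq> {}" "{z n} \<subseteq> ball 0 1" for n
    using z by (auto simp: dist_absval)

  obtain C0 \<delta> where C0: "\<forall>\<^sub>F n in u. n \<in> C0" and \<delta>: "0 < \<delta>"
    and sep: "\<And>n S. n \<in> C0 \<Longrightarrow> finite S \<Longrightarrow> S \<subseteq> C0 - {n} \<Longrightarrow>
        \<delta> \<le> (\<Prod>m\<in>S. absval (z n - z m) ^ k m)"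
    by (rule Comp_finite_products[OF z k]) (rule that; assumption)
  have "C0 \<noteq> {}"
    using eventually_happens'[OF u_bot C0] by blast
  obtain E where E: "finite E" "\<And>m. m \<in> C0 - E \<Longrightarrow> z m \<noteq> 0"
    "\<And>S. finite S \<Longrightarrow> S \<subseteq> C0 - E \<Longrightarrow> \<delta> \<le> (\<Prod>m\<in>S. absval (z m) ^ k m)"
    by (rule eventually_absval_products_ge[of z k \<delta> C0, OF z k1 \<delta> \<open>C0 \<noteq> {}\<close> sep])
       (assumption | rule that)+
  define C where "C = C0 - E"
  interpret separated_points z k C \<delta>
  proof
    show "\<delta> \<le> (\<Prod>m\<in>S. absval (z n - z m) ^ k m)" if "n \<in> C" "finite S" "S \<subseteq> C - {n}" for n S
      using that by (intro sep) (auto simp: C_def)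
    show "z m \<noteq> 0" if "m \<in> C" for m
      using that E(2) by (simp add: C_def)
    show "\<delta> \<le> (\<Prod>m\<in>S. absval (z m) ^ k m)" if "finite S" "S \<subseteq> C" for S
      using that E(3) by (simp add: C_def)
  qed (rule z k1 \<delta>)+
  have "\<forall>\<^sub>F n in sequentially. n \<notin> E"
    using E(1) by (simp add: eventually_cofinite flip: cofinite_eq_sequentially)
  then have "\<forall>\<^sub>F n in u. n \<notin> E"
    by (rule filter_leD[OF u_seq])
  with C0 have C: "\<forall>\<^sub>F n in u. n \<in> C"
    by eventually_elim (simp add: C_def)

  have "seminorm_ker \<phi> \<noteq> {0}"
  proof -
    obtain f A c where f: "coeffs_le f A" "f \<noteq> 0" and c: "filterlim c at_top sequentially"
      and small: "\<And>w n. absval w < 1 \<Longrightarrow> n \<in> C \<Longrightarrow>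
        absval (ps_eval f w) \<le> A * (absval (z n - w) ^ k n) ^ c n"
      by (rule exists_nonzero_small_on_disks) (rule that; assumption)
    have A: "0 \<le> A"
      by (rule coeffs_le_nonneg[OF f(1)])
    have "f \<in> null_ideal D u"
    proof (rule null_idealI[OF D f(1)])
      show "\<forall>\<^sub>F n in u. \<forall>w\<in>D n. absval (ps_eval f w) \<le> A * r ^ c n"
        using C
      proof (rule eventually_mono, intro ballI)
        fix n w assume n: "n \<in> C" and w: "w \<in> D n"
        have "absval (z n - w) ^ k n \<le> root (k n) r ^ k n"
          using w by (intro power_mono) (auto simp: D_def dist_absval)
        then have "(absval (z n - w) ^ k n) ^ c n \<le> r ^ c n"
          by (intro power_mono) (auto simp: rho)
        then have "A * (absval (z n - w) ^ k n) ^ c n \<le> A * r ^ c n"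
          by (intro mult_left_mono A)
        moreover have "absval w < 1"
          using w D(2) mem_ball_0_iff_absval by blast
        ultimately show "absval (ps_eval f w) \<le> A * r ^ c n"
          using small[of w n] n by simp
      qed
      have "(\<lambda>n. r ^ n) \<longlonglongrightarrow> 0"
        using r by (intro LIMSEQ_realpow_zero) auto
      from filterlim_compose[OF this c] have "(\<lambda>n. r ^ c n) \<longlonglongrightarrow> 0" .
      then show "((\<lambda>n. A * r ^ c n) \<longlongrightarrow> 0) u"
        by (intro tendsto_mult_right_zero) (rule tendsto_mono[OF u_seq])
    qed
    then show ?thesis
      using f(2) ker by blast
  qed
  moreover have "\<not> maximalideal (seminorm_ker \<phi>) Hinf"
  proof
    assume max: "maximalideal (seminorm_ker \<phi>) Hinf"
    let ?J = "null_ideal (\<lambda>n. {z n}) u"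
    have "seminorm_ker \<phi> \<subseteq> ?J"
    proof
      fix f assume "f \<in> seminorm_ker \<phi>"
      then obtain A where A: "coeffs_le f A" and f: "((\<lambda>n. zeta_disk (D n) f) \<longlongrightarrow> 0) u"
        by (auto simp: ker null_ideal_def carrier_Hinf_iff)
      show "f \<in> ?J"
        using absval_le_zeta_disk[OF D(2) A z_D] by (intro null_idealI[OF Z A _ f]) simp
    qed
    moreover have "?J \<noteq> seminorm_ker \<phi>"
    proof -
      \<comment> \<open>The bound by \<open>r\<close> places \<open>y n\<close> in the disk \<open>D n\<close>, the bound by \<open>\<delta>\<close> away from the other \<open>z m\<close>.\<close>
      obtain a :: 'a where a: "a \<noteq> 0" "absval a < min r \<delta>"
        using exists_small_absval[of "min r \<delta>"] r \<delta> by auto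
      have "\<exists>b. b ^ k n = a" for n
        using nth_root_exists[of "k n" a] k1[of n] by auto
      then obtain b where b: "\<And>n. b n ^ k n = a"
        by metis
      define y where "y n = z n + b n" for n
      have y: "absval (y n - z n) ^ k n = absval a" for n
        by (simp add: y_def b flip: absval_power)
      obtain g A where g: "coeffs_le g A" and zero: "\<And>n. n \<in> C \<Longrightarrow> ps_eval g (z n) = 0"
        and large: "\<And>n. n \<in> C \<Longrightarrow> absval a * \<delta> \<le> absval (ps_eval g (y n))"
      proof (rule exists_vanishing_but_large_nearby[OF a(1) _ y])
        show "absval a < \<delta>"
          using a by simp
      qed (rule that; assumption)
      have "g \<in> ?J"
      proof (rule null_idealI[OF Z g _ tendsto_const])
        show "\<forall>\<^sub>F n in u. \<forall>w\<in>{z n}. absval (ps_eval g w) \<le> 0"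
          using C by (rule eventually_mono) (simp add: zero)
      qed
      moreover have "g \<notin> seminorm_ker \<phi>"
      proof
        assume "g \<in> seminorm_ker \<phi>"
        then have "((\<lambda>n. zeta_disk (D n) g) \<longlongrightarrow> 0) u"
          by (simp add: ker null_ideal_def)
        then have "\<forall>\<^sub>F n in u. zeta_disk (D n) g < absval a * \<delta>"
          using a \<delta> by (intro order_tendstoD) auto
        with C have "\<forall>\<^sub>F n in u. False"
        proof eventually_elim
          case (elim n)
          have "absval (y n - z n) ^ k n \<le> root (k n) r ^ k n"
            using y[of n] rho(3)[of n] a by simp
          then have "absval (y n - z n) \<le> root (k n) r"
            using k1[of n] rho(1)[of n] by (subst (asm) power_mono_iff) auto
          then have "y n \<in> D n"
            by (simp add: D_def mem_cball_iff_absval del: mem_cball)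
          then show ?case
            using absval_le_zeta_disk[OF D(2) g] large[of n] elim by fastforce
        qed
        then show False
          using u_bot by (simp add: trivial_limit_def)
      qed
      ultimately show ?thesis by blast
    qed
    moreover have "?J \<noteq> carrier Hinf"
    proof
      assume "?J = carrier Hinf"
      then have "(1 :: 'a fps) \<in> ?J"
        using coeffs_le_1 carrier_Hinf_iff by blast
      then have "((\<lambda>n. zeta_disk {z n} 1) \<longlongrightarrow> 0) u"
        by (simp add: null_ideal_def)
      moreover have "zeta_disk {z n} 1 = 1" for n
        by (simp add: zeta_disk_def z)
      ultimately show False
        using u_bot by (simp add: tendsto_const_iff)
    qed
    moreover have "?J \<subseteq> carrier Hinf"
      by (auto simp: null_ideal_def)
    ultimately show False
      using maximalideal.I_maximal[OF max ideal_null_ideal[of "\<lambda>n. {z n}" u, OF Z]] by simp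
  qed
  moreover have "\<zero>\<^bsub>Hinf\<^esub> = (0 :: 'a fps)"
    by (simp add: Hinf_def)
  ultimately show ?thesis
    using ideal_null_ideal[OF D] ker by simp
qed

end
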